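(* Let $D=\{0,1\}^{\mathbb N}$ be the Cantor set (with the product topology). Let $X$ be a Banach space with separable dual and let $i\colon X\to C(D)$ be an isometric (linear) embedding. Then for every $\varepsilon>0$ there are a countable ordinal $\alpha<\omega^{\mathrm{Sz}(X,\varepsilon/2)+\omega}$ and a subspace $Y$ of $C(D)$ isometrically isomorphic to $C[0,\alpha]$ such that for all $x\in X$ there exists $y\in Y$ with $\|i(x)-y\|\le\varepsilon\|x\|$.
   Context: Szlenk index. For a Banach space $X$, a $w^*$-closed $F\subset B_{X^*}$ and $\varepsilon>0$ let $F'_\varepsilon$ be the set of those $\xi\in F$ such that $\mathrm{diam}_{\|\cdot\|}(U\cap F)\ge\varepsilon$ for every $w^*$-open neighbourhood $U$ of $\xi$. Put $F^{(0)}_\varepsilon=F$, $F^{(\gamma+1)}_\varepsilon=(F^{(\gamma)}_\varepsilon)'_\varepsilon$, $F^{(\alpha)}_\varepsilon=\bigcap_{\gamma<\alpha}F^{(\gamma)}_\varepsilon$ for limit $\alpha$. The $\varepsilon$-Szlenk index $\mathrm{Sz}(X,\varepsilon)$ is the least ordinal $\beta$ with $(B_{X^*})^{(\beta)}_\varepsilon=\emptyset$; it exists for every $\varepsilon>0$ when $X^*$ is separable. $C(K)$ is the Banach space of continuous real-valued functions on a compact Hausdorff space $K$ with the supremum norm; $C[0,\alpha]$ is $C(K)$ for the ordinal interval $K=[0,\alpha]$ with its order topology. Banach spaces are real. Sums and powers of ordinals are ordinal sums and ordinal powers. *)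

theory Defs
  imports "HOL-Analysis.Analysis"
begin

section \<open>Ordinals\<close>

text \<open>
  The elements of \<open>'c ordinal\<close> are the order types of the well-orders on subsets of
  \<^typ>\<open>'c + nat\<close>, that is, the ordinals of cardinality at most that of \<^typ>\<open>'c + nat\<close>. The
  summand \<^typ>\<open>nat\<close> makes the underlying type infinite, so that \<open>'c ordinal\<close> is an initial
  segment of the ordinals that contains \<open>\<omega>\<close> and is closed under successor, sum, product and power.
\<close>

unbundle cardinal_syntax

quotient_type 'c ordinal = "('c + nat) rel" / partial: "\<lambda>r s. (r, s) \<in> ordIso"
proof (rule part_equivpI)
  have "Well_order ({} :: ('c + nat) rel)" by simp
  then show "\<exists>r :: ('c + nat) rel. (r, r) \<in> ordIso" using ordIso_reflexive by blast
  show "symp (\<lambda>r s :: ('c + nat) rel. (r, s) \<in> ordIso)"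
    by (rule sympI) (rule ordIso_symmetric)
  show "transp (\<lambda>r s :: ('c + nat) rel. (r, s) \<in> ordIso)"
    by (rule transpI) (rule ordIso_transitive)
qed

lemma ordinal_rep:
  obtains r where "a = abs_ordinal r" "Well_order r"
proof
  show "a = abs_ordinal (rep_ordinal a)"
    by (rule Quotient_abs_rep[OF Quotient_ordinal, symmetric])
  have "(rep_ordinal a, rep_ordinal a) \<in> ordIso"
    by (rule Quotient_rep_reflp[OF Quotient_ordinal])
  then show "Well_order (rep_ordinal a)" by (simp add: ordIso_def)
qed

instantiation ordinal :: (type) linorder
begin

lift_definition less_eq_ordinal :: "'c ordinal \<Rightarrow> 'c ordinal \<Rightarrow> bool" is "\<lambda>r s. r \<le>o s"
  by (meson ordIso_ordLeq_trans ordIso_symmetric ordLeq_ordIso_trans)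

lift_definition less_ordinal :: "'c ordinal \<Rightarrow> 'c ordinal \<Rightarrow> bool" is "\<lambda>r s. r <o s"
  by (meson ordIso_ordLess_trans ordIso_symmetric ordLess_ordIso_trans)

instance
proof
  have wo: "Well_order r" if "(r, r) \<in> ordIso" for r :: "('c + nat) rel"
    using that by (simp add: ordIso_def)
  fix x y z :: "'c ordinal"
  show "(x < y) = (x \<le> y \<and> \<not> y \<le> x)"
  proof transfer
    fix r s :: "('c + nat) rel"
    assume "(r, r) \<in> ordIso" "(s, s) \<in> ordIso"
    then have "\<not> s \<le>o r \<longleftrightarrow> r <o s" by (intro not_ordLeq_iff_ordLess wo)
    then show "r <o s \<longleftrightarrow> r \<le>o s \<and> \<not> s \<le>o r" using ordLess_imp_ordLeq by auto
  qed
  show "x \<le> x"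
    by transfer (simp add: ordIso_iff_ordLeq)
  show "x \<le> z" if "x \<le> y" "y \<le> z"
    using that by transfer (rule ordLeq_transitive)
  show "x = y" if "x \<le> y" "y \<le> x"
    using that by transfer (simp add: ordIso_iff_ordLeq)
  show "x \<le> y \<or> y \<le> x"
    by transfer (intro ordLeq_total wo)
qed

end

instance ordinal :: (type) wellorder
proof (rule wf_wellorderI)
  show "wf {(x :: 'c ordinal, y). x < y}"
    by (rule wf_subset[OF wf_inv_image[OF wf_ordLess, where f = rep_ordinal]])
      (auto simp: less_ordinal_def in_inv_image)
qed intro_classes

instantiation ordinal :: (type) linorder_topology
begin

definition open_ordinal :: "'c ordinal set \<Rightarrow> bool"
  where "open_ordinal = generate_topology (range (\<lambda>a. {..<a}) \<union> range (\<lambda>a. {a<..}))"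

instance by intro_classes (rule open_ordinal_def)

end

lemma abs_ordinal_less_iff:
  "Well_order r \<Longrightarrow> Well_order s \<Longrightarrow> abs_ordinal r < abs_ordinal s \<longleftrightarrow> r <o s"
  by (simp add: less_ordinal.abs_eq ordIso_reflexive)

lemma abs_ordinal_eq_iff:
  "Well_order r \<Longrightarrow> Well_order s \<Longrightarrow> abs_ordinal r = abs_ordinal s \<longleftrightarrow> (r, s) \<in> ordIso"
  using Quotient_rel[OF Quotient_ordinal, of r s] ordIso_reflexive[of r] ordIso_reflexive[of s]
  by simp

lemma strict_mono_le_self:
  fixes g :: "'a :: wellorder \<Rightarrow> 'a"
  assumes "strict_mono g"
  shows "a \<le> g a"
proof (induction a rule: less_induct)
  case (less a)
  show ?case
  proof (rule ccontr)
    assume "\<not> a \<le> g a"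
    then have "g a < a" by simp
    then show False using less[of "g a"] strict_monoD[OF assms, of "g a" a] by simp
  qed
qed

text \<open>Hartogs' theorem: the type of ordinals does not embed into the type it is built over.\<close>

lemma not_inj_ordinal: "\<not> inj (f :: 'c ordinal \<Rightarrow> 'c + nat)"
proof
  assume inj: "inj f"
  define R :: "'c ordinal rel" where "R = {(a, b). a \<le> b}"
  have FR: "Field R = UNIV" by (auto simp: R_def Field_def)
  have "R - Id = {(a, b). a < b}" by (auto simp: R_def)
  then have "wf (R - Id)" by (simp add: wf)
  then have WR: "Well_order R"
    by (auto simp: FR R_def Field_def well_order_on_def linear_order_on_def partial_order_on_def
        preorder_on_def refl_on_def total_on_def antisym_def intro!: transI)
  define s where "s = dir_image R f"
  have Ws: "Well_order s"
    unfolding s_def by (rule Well_order_dir_image[OF WR]) (use inj FR in simp)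
  have Fs: "Field s = range f" by (simp add: s_def dir_image_Field FR)
  define g where "g a = abs_ordinal (Restr s (underS s (f a)))" for a
  have under: "underS s (f a) = f ` {..<a}" for a
    using inj by (auto simp: underS_def s_def dir_image_def R_def inj_eq order_less_le)
  have of: "wo_rel.ofilter s (underS s (f a))" for a
    using Ws by (simp add: wo_rel_def wo_rel.underS_ofilter)
  have Wr: "Well_order (Restr s (underS s (f a)))" for a
    by (rule Well_order_Restr[OF Ws])
  have "strict_mono g"
  proof (rule strict_monoI)
    fix a b :: "'c ordinal"
    assume ab: "a < b"
    then have "underS s (f a) \<subset> underS s (f b)"
      unfolding under using inj by (auto simp: inj_image_subset_iff inj_image_eq_iff)
    then show "g a < g b"
      unfolding g_def by (simp add: abs_ordinal_less_iff Wr ofilter_subset_ordLess[OF Ws of of])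
  qed
  then have "abs_ordinal s \<le> g (abs_ordinal s)" by (rule strict_mono_le_self)
  moreover have "g a < abs_ordinal s" for a
    unfolding g_def using Fs by (subst abs_ordinal_less_iff[OF Wr Ws]) (auto intro!: underS_Restr_ordLess[OF Ws])
  ultimately show False by (meson not_le)
qed

lemma ordinal_lessThan_inj: "\<exists>f :: 'c ordinal \<Rightarrow> 'c + nat. inj_on f {..<a}"
proof -
  obtain r where r: "a = abs_ordinal r" "Well_order r" by (rule ordinal_rep)
  have "\<exists>c. b = abs_ordinal (Restr r (underS r c))" if ba: "b < a" for b
  proof -
    obtain q where q: "b = abs_ordinal q" "Well_order q" by (rule ordinal_rep)
    then have "q <o r" using ba r by (simp add: abs_ordinal_less_iff)
    then obtain c where "(q, Restr r (underS r c)) \<in> ordIso"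
      using ordLess_iff_ordIso_Restr r(2) q(2) by blast
    then show ?thesis
      using q abs_ordinal_eq_iff[OF q(2) Well_order_Restr[OF r(2)]] by blast
  qed
  then obtain f where "\<And>b. b < a \<Longrightarrow> b = abs_ordinal (Restr r (underS r (f b)))" by metis
  then have "inj_on f {..<a}" by (metis inj_onI lessThan_iff)
  then show ?thesis by blast
qed

lemma ordinal_bounded:
  fixes A :: "'c ordinal set" and h :: "'c ordinal \<Rightarrow> 'c + nat"
  assumes "inj_on h A"
  shows "\<exists>b. \<forall>a\<in>A. a < b"
proof (rule ccontr)
  assume "\<not> ?thesis"
  then have un: "\<exists>a\<in>A. b \<le> a" for b by (meson not_le)
  have inf: "infinite (UNIV :: ('c + nat) set)" by simp
  have "|{..a}| \<le>o |UNIV :: ('c + nat) set|" for a :: "'c ordinal"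
  proof -
    have "|{..<a}| \<le>o |UNIV :: ('c + nat) set|"
      using ordinal_lessThan_inj[of a] unfolding card_of_ordLeq[symmetric] by simp
    moreover have "|{a}| \<le>o |UNIV :: ('c + nat) set|"
      by (simp add: card_of_singl_ordLeq)
    moreover have "infinite (Field |UNIV :: ('c + nat) set| )" by (subst Field_card_of) (rule inf)
    ultimately have "|{..<a} \<union> {a}| \<le>o |UNIV :: ('c + nat) set|"
      by (intro card_of_Un_ordLeq_infinite_Field) (simp_all add: card_of_Card_order card_of_well_order_on)
    moreover have "{..<a} \<union> {a} = {..a}" by auto
    ultimately show ?thesis by simp
  qed
  then have "\<forall>a\<in>A. |{..a}| \<le>o |UNIV :: ('c + nat) set|" by blast
  moreover have "|A| \<le>o |UNIV :: ('c + nat) set|"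
    using assms unfolding card_of_ordLeq[symmetric] by blast
  ultimately have "|\<Union>a\<in>A. {..a}| \<le>o |UNIV :: ('c + nat) set|"
    by (intro card_of_UNION_ordLeq_infinite[OF inf])
  moreover have "(\<Union>a\<in>A. {..a}) = UNIV" using un by blast
  ultimately have "|UNIV :: 'c ordinal set| \<le>o |UNIV :: ('c + nat) set|" by simp
  then obtain f :: "'c ordinal \<Rightarrow> 'c + nat" where "inj f"
    unfolding card_of_ordLeq[symmetric] by blast
  then show False using not_inj_ordinal by blast
qed

unbundle no cardinal_syntax

definition osuc :: "'c ordinal \<Rightarrow> 'c ordinal"
  where "osuc a = (LEAST b. a < b)"

lemma less_osuc: "a < osuc a"
proof -
  have "\<exists>b. a < b" using ordinal_bounded[of _ "{a}"] by auto
  then show ?thesis unfolding osuc_def by (rule LeastI_ex)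
qed

lemma osuc_le_iff: "osuc a \<le> b \<longleftrightarrow> a < b"
proof
  show "a < b" if "osuc a \<le> b" using less_osuc that by (rule order_less_le_trans)
  show "osuc a \<le> b" if "a < b" using that unfolding osuc_def by (rule Least_le)
qed

lemma osuc_inject: "osuc a = osuc b \<longleftrightarrow> a = b"
proof (cases a b rule: linorder_cases)
  case less
  then have "osuc a < osuc b" using less_osuc[of b] osuc_le_iff[of a b] by auto
  then show ?thesis using less by auto
next
  case greater
  then have "osuc b < osuc a" using less_osuc[of a] osuc_le_iff[of b a] by auto
  then show ?thesis using greater by auto
qed simp

text \<open>The supremum; it exists for every bounded set of ordinals.\<close>

definition osup :: "'c ordinal set \<Rightarrow> 'c ordinal"
  where "osup A = (LEAST b. \<forall>a\<in>A. a \<le> b)"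

lemma osup_upper:
  fixes f :: "'c ordinal \<Rightarrow> 'c ordinal"
  assumes "b < a"
  shows "f b \<le> osup (f ` {..<a})"
proof -
  obtain h :: "'c ordinal \<Rightarrow> 'c + nat" where "inj_on h {..<a}"
    using ordinal_lessThan_inj by blast
  then have "inj_on h (inv_into {..<a} f ` f ` {..<a})"
    by (rule inj_on_subset) (intro image_subsetI inv_into_into)
  then have "inj_on (h \<circ> inv_into {..<a} f) (f ` {..<a})"
    by (rule comp_inj_on[OF inj_on_inv_into[OF order_refl]])
  then obtain u where "\<forall>x\<in>f ` {..<a}. x < u"
    using ordinal_bounded by blast
  then have "\<exists>u. \<forall>x\<in>f ` {..<a}. x \<le> u"
    by (intro exI[of _ u] ballI order_less_imp_le) (rule bspec)
  then have "\<forall>x\<in>f ` {..<a}. x \<le> osup (f ` {..<a})"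
    unfolding osup_def by (rule LeastI_ex)
  then show ?thesis using assms by blast
qed

instantiation ordinal :: (type) "{zero, one}"
begin

definition zero_ordinal :: "'c ordinal"
  where "zero_ordinal = (LEAST a. True)"

definition one_ordinal :: "'c ordinal"
  where "one_ordinal = osuc 0"

instance ..

end

text \<open>
  Transfinite recursion: initial value \<open>z\<close>, successor step \<open>s\<close>, and a limit step \<open>l\<close> that is
  given the set of all earlier values.
\<close>

function ord_rec :: "'r \<Rightarrow> ('r \<Rightarrow> 'r) \<Rightarrow> ('r set \<Rightarrow> 'r) \<Rightarrow> 'c ordinal \<Rightarrow> 'r" where
  "ord_rec z s l a =
    (if a = 0 then z
     else if \<exists>b. a = osuc b then s (ord_rec z s l (THE b. a = osuc b))
     else l (ord_rec z s l ` {..<a}))"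
  by pat_completeness auto
termination
proof (relation "inv_image {(a :: 'c ordinal, b). a < b} (\<lambda>(z, s, l, a). a)")
  show "wf (inv_image {(a :: 'c ordinal, b). a < b} (\<lambda>(z, s, l, a). a))"
    by (rule wf_inv_image[OF wf])
next
  fix z :: 'r and s l and a :: "'c ordinal"
  assume "\<exists>b. a = osuc b"
  then obtain b where b: "a = osuc b" by blast
  then have "(THE b. a = osuc b) = b" by (simp add: osuc_inject)
  then show "((z, s, l, THE b. a = osuc b), (z, s, l, a))
      \<in> inv_image {(a :: 'c ordinal, b). a < b} (\<lambda>(z, s, l, a). a)"
    by (simp add: b less_osuc)
qed simp

declare ord_rec.simps [simp del]

instantiation ordinal :: (type) "{plus, times}"
begin

definition plus_ordinal :: "'a ordinal \<Rightarrow> 'a ordinal \<Rightarrow> 'a ordinal"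
  where "a + b = ord_rec a osuc osup b"

definition times_ordinal :: "'a ordinal \<Rightarrow> 'a ordinal \<Rightarrow> 'a ordinal"
  where "a * b = ord_rec 0 (\<lambda>x. x + a) osup b"

instance ..

end

lemma ordinal_zero_le: "(0 :: 'c ordinal) \<le> a"
  unfolding zero_ordinal_def by (rule Least_le) simp

definition olimit :: "'c ordinal \<Rightarrow> bool"
  where "olimit a \<longleftrightarrow> a \<noteq> 0 \<and> (\<forall>b<a. osuc b < a)"

lemma ord_rec_zero: "ord_rec z s l 0 = z"
  by (subst ord_rec.simps) simp

lemma ord_rec_osuc: "ord_rec z s l (osuc a) = s (ord_rec z s l a)"
proof -
  have "osuc a \<noteq> 0" using less_osuc[of a] ordinal_zero_le[of a] by (metis not_le)
  moreover have "(THE b. osuc a = osuc b) = a" by (simp add: osuc_inject)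
  ultimately show ?thesis by (subst ord_rec.simps) (simp add: osuc_inject)
qed

lemma ord_rec_olimit:
  assumes "olimit a"
  shows "ord_rec z s l a = l (ord_rec z s l ` {..<a})"
proof -
  have "\<nexists>b. a = osuc b" using assms less_osuc unfolding olimit_def by (metis order_less_irrefl)
  moreover have "a \<noteq> 0" using assms by (simp add: olimit_def)
  ultimately show ?thesis by (subst ord_rec.simps) (simp only: if_False)
qed

definition omega :: "'c ordinal"  (\<open>\<omega>\<close>)
  where "\<omega> = (LEAST a. olimit a)"

lemma olimit_omega: "olimit (\<omega> :: 'c ordinal)"
proof -
  define e :: "nat \<Rightarrow> 'c ordinal" where "e n = (osuc ^^ n) 0" for n
  have "inj_on (Inr \<circ> inv e :: 'c ordinal \<Rightarrow> 'c + nat) (range e)"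
    by (rule comp_inj_on[OF inj_on_inv_into[OF order_refl]]) simp
  then have "\<exists>b. \<forall>x\<in>range e. x < b" by (rule ordinal_bounded)
  then have ex: "\<exists>b. \<forall>n. e n < b" by simp
  define b where "b = (LEAST b. \<forall>n. e n < b)"
  have b: "e n < b" for n
    using LeastI_ex[OF ex] unfolding b_def by (rule spec)
  have "olimit b"
    unfolding olimit_def
  proof (intro conjI allI impI)
    show "b \<noteq> 0" using b[of 0] by (simp add: e_def)
    fix c assume "c < b"
    then have "\<not> (\<forall>n. e n < c)" unfolding b_def by (rule not_less_Least)
    then obtain n where "c \<le> e n" by (auto simp: not_less)
    then have "osuc c \<le> e (Suc n)"
      using less_osuc[of "e n"] by (simp add: e_def osuc_le_iff)
    then show "osuc c < b" using b order_le_less_trans by blast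
  qed
  then show ?thesis unfolding omega_def by (rule LeastI)
qed

text \<open>The ordinal power; the limit clause is the usual one for bases \<open>a \<noteq> 0\<close>.\<close>

definition oexp :: "'c ordinal \<Rightarrow> 'c ordinal \<Rightarrow> 'c ordinal"
  where "oexp a b = ord_rec 1 (\<lambda>x. x * a) osup b"

section \<open>The Szlenk index\<close>

text \<open>
  On the dual \<open>'x \<Rightarrow>\<^sub>L real\<close> the library's strong operator topology, the topology of pointwise
  convergence, is the weak-star topology. The derivation is only applied to bounded sets, on which
  \<^const>\<open>diameter\<close> is the norm diameter.
\<close>

definition szlenk_derivation ::
    "real \<Rightarrow> ('x :: real_normed_vector \<Rightarrow>\<^sub>L real) set \<Rightarrow> ('x \<Rightarrow>\<^sub>L real) set"
  where "szlenk_derivation \<epsilon> F =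
    {\<xi> \<in> F. \<forall>U. openin strong_operator_topology U \<and> \<xi> \<in> U \<longrightarrow> \<epsilon> \<le> diameter (U \<inter> F)}"

definition szlenk_derived ::
    "real \<Rightarrow> ('x :: real_normed_vector \<Rightarrow>\<^sub>L real) set \<Rightarrow> 'c ordinal \<Rightarrow> ('x \<Rightarrow>\<^sub>L real) set"
  where "szlenk_derived \<epsilon> F = ord_rec F (szlenk_derivation \<epsilon>) Inter"

text \<open>
  The ordinals over \<open>'x \<Rightarrow>\<^sub>L real\<close> suffice for the Szlenk index: by the lemma
  \<open>szlenk_derived_stationary\<close> below, the derived sets become stationary within this type, so if
  some ordinal makes them empty, then one of this type does.
\<close>

definition Sz :: "'x :: real_normed_vector itself \<Rightarrow> real \<Rightarrow> ('x \<Rightarrow>\<^sub>L real) ordinal"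
  where "Sz X \<epsilon> = (LEAST \<beta>. szlenk_derived \<epsilon> (cball (0 :: 'x \<Rightarrow>\<^sub>L real) 1) \<beta> = {})"

lemma szlenk_derived_zero: "szlenk_derived \<epsilon> F 0 = F"
  by (simp add: szlenk_derived_def ord_rec_zero)

lemma szlenk_derived_osuc:
  "szlenk_derived \<epsilon> F (osuc a) = szlenk_derivation \<epsilon> (szlenk_derived \<epsilon> F a)"
  by (simp add: szlenk_derived_def ord_rec_osuc)

lemma szlenk_derived_olimit:
  "olimit a \<Longrightarrow> szlenk_derived \<epsilon> F a = (\<Inter>b<a. szlenk_derived \<epsilon> F b)"
  by (simp add: szlenk_derived_def ord_rec_olimit)

lemma ordinal_cases:
  obtains "a = 0" | b where "a = osuc b" | "olimit a"
proof -
  have "osuc b = a \<or> osuc b < a" if "b < a" for b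
    using that osuc_le_iff[of b a] by (simp add: order_le_less disj_commute)
  then have "a = 0 \<or> (\<exists>b. a = osuc b) \<or> olimit a" unfolding olimit_def by blast
  then show thesis using that by blast
qed

lemma szlenk_derived_antimono:
  "b \<le> a \<Longrightarrow> szlenk_derived \<epsilon> F a \<subseteq> szlenk_derived \<epsilon> F b"
proof (induction a arbitrary: b rule: less_induct)
  case (less a)
  consider "b = a" | "b < a" using less.prems by fastforce
  then show ?case
  proof cases
    case 2
    show ?thesis
    proof (cases a rule: ordinal_cases)
      case 1
      then show ?thesis using 2 ordinal_zero_le[of b] by simp
    next
      case (2 c)
      then have "b \<le> c" using \<open>b < a\<close> osuc_le_iff[of c b] by auto
      moreover have "c < a" using 2 less_osuc by simp
      ultimately have "szlenk_derived \<epsilon> F c \<subseteq> szlenk_derived \<epsilon> F b" using less.IH by blast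
      moreover have "szlenk_derived \<epsilon> F a \<subseteq> szlenk_derived \<epsilon> F c"
        unfolding 2 szlenk_derived_osuc szlenk_derivation_def by blast
      ultimately show ?thesis by blast
    next
      case 3
      then show ?thesis using 2 by (auto simp: szlenk_derived_olimit)
    qed
  qed simp
qed

lemma szlenk_derived_stationary:
  fixes F :: "('x :: real_normed_vector \<Rightarrow>\<^sub>L real) set"
  shows "\<exists>a :: ('x \<Rightarrow>\<^sub>L real) ordinal. szlenk_derived \<epsilon> F (osuc a) = szlenk_derived \<epsilon> F a"
proof (rule ccontr)
  assume "\<not> ?thesis"
  moreover have "szlenk_derived \<epsilon> F (osuc a) \<subseteq> szlenk_derived \<epsilon> F a"
    for a :: "('x \<Rightarrow>\<^sub>L real) ordinal"
    using less_osuc[of a] by (intro szlenk_derived_antimono) simp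
  ultimately have "\<forall>a :: ('x \<Rightarrow>\<^sub>L real) ordinal. \<exists>\<xi>.
      \<xi> \<in> szlenk_derived \<epsilon> F a \<and> \<xi> \<notin> szlenk_derived \<epsilon> F (osuc a)" by blast
  then obtain g :: "('x \<Rightarrow>\<^sub>L real) ordinal \<Rightarrow> 'x \<Rightarrow>\<^sub>L real"
    where g: "\<And>a. g a \<in> szlenk_derived \<epsilon> F a" "\<And>a. g a \<notin> szlenk_derived \<epsilon> F (osuc a)" by metis
  have "g a \<noteq> g b" if "a < b" for a b
    using g szlenk_derived_antimono[of "osuc a" b \<epsilon> F] that osuc_le_iff[of a b] by (metis subsetD)
  then have "inj (Inl \<circ> g :: _ \<Rightarrow> ('x \<Rightarrow>\<^sub>L real) + nat)"
    by (intro injI) (metis Inl_inject comp_apply linorder_neqE)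
  then show False using not_inj_ordinal by blast
qed

section \<open>Spaces of continuous functions\<close>

text \<open>
  For \<open>K\<close> a compact subset of a topological type, \<open>C(K)\<close> is represented by the functions
  that are continuous on \<open>K\<close> and vanish outside \<open>K\<close>; the linear structure is pointwise.
  For an ordinal \<open>\<alpha>\<close>, the subspace topology of \<open>{0..\<alpha>}\<close> is its order topology, since
  \<open>{0..\<alpha>}\<close> is an initial segment.
\<close>

definition cont_functions :: "'k :: topological_space set \<Rightarrow> ('k \<Rightarrow> real) set"
  where "cont_functions K = {f. continuous_on K f \<and> (\<forall>t. t \<notin> K \<longrightarrow> f t = 0)}"

definition sup_norm :: "'k set \<Rightarrow> ('k \<Rightarrow> real) \<Rightarrow> real"
  where "sup_norm K f = (SUP t\<in>K. \<bar>f t\<bar>)"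

definition isometrically_isomorphic_C ::
    "'v :: real_normed_vector set \<Rightarrow> 'k :: topological_space set \<Rightarrow> bool"
  where "isometrically_isomorphic_C Y K \<longleftrightarrow>
    (\<exists>T. bij_betw T (cont_functions K) Y \<and>
      (\<forall>f\<in>cont_functions K. \<forall>g\<in>cont_functions K. T (\<lambda>t. f t + g t) = T f + T g) \<and>
      (\<forall>c. \<forall>f\<in>cont_functions K. T (\<lambda>t. c * f t) = c *\<^sub>R T f) \<and>
      (\<forall>f\<in>cont_functions K. norm (T f) = sup_norm K f))"

type_synonym cantor = "nat \<Rightarrow> bool"

end

theory Submission
  imports Defs
begin

text \<open>
  Let \<open>q t\<close> be the functional \<open>x \<mapsto> i x t\<close>, a weak-star continuous map from the Cantor set
  to the dual ball, and pull the \<open>\<epsilon>/2\<close>-Szlenk derived sets of the ball back along \<open>q\<close> to closed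
  sets \<open>E b\<close>. By induction on \<open>b\<close>, every clopen set disjoint from \<open>E b\<close> maps continuously onto
  an initial segment \<open>{..<a}\<close> with \<open>a < \<omega>\<^sup>b\<close> such that \<open>q\<close> varies by less than \<open>\<epsilon>/2\<close> on
  each fibre. In the successor step, compactness reduces to a clopen set \<open>A\<close> on whose
  intersection with \<open>E b\<close> the map \<open>q\<close> varies little; the rest of \<open>A\<close> is a countable disjoint
  union of clopen sets, whose maps are placed one after another, and \<open>A \<inter> E b\<close> is sent to the
  supremum. With \<open>b = Sz(X, \<epsilon>/2)\<close> this gives a continuous surjection \<open>\<phi>\<close> of the Cantor set onto
  some \<open>[0, \<alpha>]\<close>, and \<open>Y\<close> consists of the functions \<open>f \<circ> \<phi>\<close>. Since \<open>i x\<close> oscillates by less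
  than \<open>\<epsilon> \<parallel>x\<parallel>\<close> on the fibres of \<open>\<phi>\<close>, a locally constant choice of values approximates it.
\<close>

section \<open>Ordinal arithmetic\<close>

lemma ordinal_not_less_zero: "\<not> a < (0 :: 'c ordinal)"
  using ordinal_zero_le[of a] by simp

lemma less_osuc_iff: "a < osuc b \<longleftrightarrow> a \<le> b"
  using osuc_le_iff[of b a] by (simp add: not_le[symmetric])

lemma osuc_mono_iff: "osuc a < osuc b \<longleftrightarrow> a < b"
  by (simp add: less_osuc_iff osuc_le_iff)

lemma ordinal_induct [case_names zero osuc olimit]:
  fixes a :: "'c ordinal"
  assumes "P 0" and "\<And>a. P a \<Longrightarrow> P (osuc a)"
    and "\<And>a. olimit a \<Longrightarrow> (\<And>b. b < a \<Longrightarrow> P b) \<Longrightarrow> P a"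
  shows "P a"
proof (induction a rule: less_induct)
  case (less a)
  show ?case
    by (cases a rule: ordinal_cases) (use assms less less_osuc in \<open>blast+\<close>)
qed

lemma osup_image_le:
  fixes f :: "'c ordinal \<Rightarrow> 'c ordinal"
  assumes "\<And>b. b < a \<Longrightarrow> f b \<le> u"
  shows "osup (f ` {..<a}) \<le> u"
  unfolding osup_def by (rule Least_le) (use assms in auto)

lemma less_osup_image_iff:
  fixes f :: "'c ordinal \<Rightarrow> 'c ordinal"
  shows "u < osup (f ` {..<a}) \<longleftrightarrow> (\<exists>b<a. u < f b)"
  using osup_image_le[of a f u] osup_upper[of _ a f] by (meson not_le order_less_le_trans)

section \<open>Ordinal addition\<close>

lemma oplus_zero: "a + 0 = (a :: 'c ordinal)"
  by (simp add: plus_ordinal_def ord_rec_zero)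

lemma oplus_osuc: "a + osuc b = osuc (a + b)"
  by (simp add: plus_ordinal_def ord_rec_osuc)

lemma oplus_olimit: "olimit b \<Longrightarrow> a + b = osup ((+) a ` {..<b})"
  by (simp add: plus_ordinal_def ord_rec_olimit cong: image_cong)

lemma oplus_strict_mono_right:
  fixes a :: "'c ordinal"
  shows "b < c \<Longrightarrow> a + b < a + c"
proof (induction c arbitrary: b rule: ordinal_induct)
  case zero
  then show ?case by (simp add: ordinal_not_less_zero)
next
  case (osuc c)
  then have "b \<le> c" by (simp add: less_osuc_iff)
  then have "a + b \<le> a + c" using osuc.IH by (metis order_le_less)
  then show ?case by (simp add: oplus_osuc less_osuc_iff)
next
  case (olimit c)
  then have "osuc b < c" by (simp add: olimit_def)
  then have "\<exists>d<c. a + b < a + d" using olimit.IH less_osuc by blast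
  then show ?case using olimit.hyps by (simp add: oplus_olimit less_osup_image_iff)
qed

lemma oplus_less_iff: "a + b < a + c \<longleftrightarrow> b < (c :: 'c ordinal)"
  by (metis linorder_less_linear oplus_strict_mono_right order_less_asym)

lemma oplus_eq_iff: "a + b = a + c \<longleftrightarrow> b = (c :: 'c ordinal)"
  by (metis linorder_less_linear oplus_strict_mono_right order_less_irrefl)

lemma le_oplus_left: "a \<le> a + (b :: 'c ordinal)"
  by (metis oplus_zero oplus_less_iff ordinal_not_less_zero not_le)

text \<open>This is left subtraction. Only the limit case of the induction on \<open>c\<close> has
  to produce a new candidate.\<close>

lemma oplus_diff:
  fixes a :: "'c ordinal"
  assumes "a \<le> c"
  obtains b where "c = a + b"
proof -
  have "\<exists>b. c = a + b"
    using assms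
  proof (induction c rule: ordinal_induct)
    case zero
    then show ?case using ordinal_zero_le[of a] oplus_zero by (metis antisym)
  next
    case (osuc c)
    then show ?case
      by (metis oplus_zero oplus_osuc order_le_less less_osuc_iff)
  next
    case (olimit c)
    \<comment> \<open>The least \<open>b\<close> whose sum reaches \<open>c\<close> hits it exactly.
      An overshoot is impossible at zero since \<open>a \<le> c\<close>, at a successor since
      \<open>c\<close> is a limit, and at a limit since \<open>a + b\<close> is then the supremum of
      sums that stay below \<open>c\<close>.\<close>
    define b where "b = (LEAST b. c \<le> a + b)"
    have "c \<le> a + c"
      by (rule strict_mono_le_self) (simp add: strict_mono_def oplus_strict_mono_right)
    then have b: "c \<le> a + b" unfolding b_def by (rule LeastI)
    have "\<not> c < a + b"
    proof
      assume less: "c < a + b"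
      have min: "a + d < c" if "d < b" for d
        using not_less_Least[OF that[unfolded b_def]] by simp
      show False
      proof (cases b rule: ordinal_cases)
        case 1
        then show False using less olimit.prems by (simp add: oplus_zero)
      next
        case (2 d)
        then have "osuc (a + d) < c" using min[of d] olimit.hyps less_osuc by (auto simp: olimit_def)
        then show False using less 2 by (simp add: oplus_osuc)
      next
        case 3
        then show False using less min by (auto simp: oplus_olimit less_osup_image_iff dest: order_less_asym)
      qed
    qed
    then show ?case using b by (metis order_le_less)
  qed
  then show thesis using that by blast
qed

text \<open>This splitting is what allows maps onto two initial segments to be placed one after the
  other.\<close>

lemma lessThan_oplus: "{..<a + b} = {..<a} \<union> (+) a ` {..<(b :: 'c ordinal)}"
proof (intro set_eqI iffI)
  fix c assume "c \<in> {..<a + b}"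
  then show "c \<in> {..<a} \<union> (+) a ` {..<b}"
    by (cases "a \<le> c") (auto elim: oplus_diff simp: oplus_less_iff)
qed (auto simp: oplus_less_iff intro: order_less_le_trans[OF _ le_oplus_left])

lemma oplus_mono_left:
  fixes a :: "'c ordinal"
  assumes "a \<le> b"
  shows "a + c \<le> b + c"
proof (induction c rule: ordinal_induct)
  case zero
  then show ?case using assms by (simp add: oplus_zero)
next
  case (osuc c)
  then show ?case by (simp add: oplus_osuc osuc_le_iff less_osuc_iff)
next
  case (olimit c)
  have "a + d \<le> b + c" if "d < c" for d
    using olimit.IH[OF that] oplus_strict_mono_right[OF that, of b] by simp
  then show ?case using olimit.hyps by (simp add: oplus_olimit osup_image_le)
qed

lemma zero_oplus: "0 + a = (a :: 'c ordinal)"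
proof (induction a rule: ordinal_induct)
  case (olimit a)
  have "0 + a \<le> a" unfolding oplus_olimit[OF olimit.hyps]
    by (rule osup_image_le) (simp add: olimit.IH order_less_imp_le)
  moreover have "a \<le> 0 + a"
    by (rule strict_mono_le_self) (simp add: strict_mono_def oplus_strict_mono_right)
  ultimately show ?case by simp
qed (simp_all add: oplus_zero oplus_osuc)

lemma olimit_oplus:
  fixes a :: "'c ordinal"
  assumes "olimit b"
  shows "olimit (a + b)"
proof -
  have "0 < b" using assms ordinal_zero_le[of b] by (auto simp: olimit_def order_less_le)
  then have "a + b \<noteq> 0" using oplus_strict_mono_right ordinal_not_less_zero by metis
  moreover have "osuc c < a + b" if "c < a + b" for c
  proof -
    obtain d where d: "d < b" "c < a + d"
      using \<open>c < a + b\<close> assms by (auto simp: oplus_olimit less_osup_image_iff)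
    then have "osuc c \<le> a + d" by (simp add: osuc_le_iff)
    then show ?thesis using oplus_strict_mono_right[OF d(1), of a] by simp
  qed
  ultimately show ?thesis by (simp add: olimit_def)
qed

lemma oplus_assoc: "(a + b) + c = a + (b + (c :: 'c ordinal))"
proof (induction c rule: ordinal_induct)
  case zero
  then show ?case by (simp add: oplus_zero)
next
  case (osuc c)
  then show ?case by (simp add: oplus_osuc)
next
  case (olimit c)
  have "(a + b) + c \<le> a + (b + c)"
    unfolding oplus_olimit[OF olimit.hyps, of "a + b"]
    by (rule osup_image_le) (simp add: olimit.IH oplus_strict_mono_right order_less_imp_le)
  moreover have "a + (b + c) \<le> (a + b) + c"
    unfolding oplus_olimit[OF olimit_oplus[OF olimit.hyps], of a]
  proof (rule osup_image_le)
    fix d assume "d < b + c"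
    then obtain e where e: "e < c" "d < b + e"
      using olimit.hyps by (auto simp: oplus_olimit less_osup_image_iff)
    then have "a + d < a + b + e" using olimit.IH by (simp add: oplus_strict_mono_right)
    then show "a + d \<le> (a + b) + c"
      using oplus_strict_mono_right[OF e(1), of "a + b"] by simp
  qed
  ultimately show ?case by simp
qed

lemma oplus_strict_mono_both:
  fixes a :: "'c ordinal"
  shows "a \<le> c \<Longrightarrow> b < d \<Longrightarrow> a + b < c + d"
  using oplus_mono_left oplus_strict_mono_right order_le_less_trans by blast

section \<open>Multiples and powers of \<omega>\<close>

lemma less_omegaE:
  fixes a :: "'c ordinal"
  assumes "a < \<omega>"
  obtains n where "a = (osuc ^^ n) 0"
proof -
  have "\<exists>n. a = (osuc ^^ n) 0"
    using assms
  proof (induction a rule: ordinal_induct)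
    case zero
    show ?case by (rule exI[of _ 0]) simp
  next
    case (osuc a)
    then obtain n where "a = (osuc ^^ n) 0" using order_less_trans[OF less_osuc] by blast
    then show ?case by (intro exI[of _ "Suc n"]) simp
  next
    case (olimit a)
    then show ?case unfolding omega_def using not_less_Least[of a olimit] by simp
  qed
  then show thesis using that by blast
qed

lemma funpow_osuc_less_omega: "(osuc ^^ n) 0 < (\<omega> :: 'c ordinal)"
  by (induction n) (use olimit_omega ordinal_zero_le[of \<omega>] in \<open>auto simp: olimit_def order_less_le\<close>)

lemma otimes_funpow_Suc:
  fixes a :: "'c ordinal"
  shows "a * (osuc ^^ Suc n) 0 = a * (osuc ^^ n) 0 + a"
  by (simp add: times_ordinal_def ord_rec_osuc)

text \<open>Every ordinal below \<omega> is an iterate \<open>(osuc ^^ n) 0\<close>, so the supremum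
  defining the product runs over finite multiples.\<close>

lemma less_otimes_omega_iff:
  fixes a :: "'c ordinal"
  shows "b < a * \<omega> \<longleftrightarrow> (\<exists>n. b < a * (osuc ^^ n) 0)"
proof -
  have "a * \<omega> = osup ((*) a ` {..<\<omega>})"
    by (simp add: times_ordinal_def ord_rec_olimit olimit_omega cong: image_cong)
  then show ?thesis
    by (auto simp: less_osup_image_iff intro: funpow_osuc_less_omega elim: less_omegaE)
qed

lemma otimes_funpow_add:
  fixes a :: "'c ordinal"
  shows "a * (osuc ^^ m) 0 + a * (osuc ^^ n) 0 = a * (osuc ^^ (m + n)) 0"
proof (induction n)
  case 0
  then show ?case by (simp add: times_ordinal_def ord_rec_zero oplus_zero)
next
  case (Suc n)
  have "a * (osuc ^^ m) 0 + a * (osuc ^^ Suc n) 0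
      = (a * (osuc ^^ m) 0 + a * (osuc ^^ n) 0) + a"
    by (simp only: otimes_funpow_Suc oplus_assoc)
  then show ?case using Suc.IH otimes_funpow_Suc[of a "m + n"] by simp
qed

lemma oexp_zero: "oexp a 0 = 1"
  by (simp add: oexp_def ord_rec_zero)

lemma oexp_osuc: "oexp a (osuc b) = oexp a b * a"
  by (simp add: oexp_def ord_rec_osuc)

lemma oexp_olimit: "olimit b \<Longrightarrow> oexp a b = osup (oexp a ` {..<b})"
  by (simp add: oexp_def ord_rec_olimit cong: image_cong)

lemma oexp_omega_osuc_ge:
  fixes b :: "'c ordinal"
  shows "oexp \<omega> b \<le> oexp \<omega> (osuc b)"
proof -
  have "oexp \<omega> b \<le> oexp \<omega> b * (osuc ^^ 1) 0"
    by (simp add: times_ordinal_def ord_rec_osuc ord_rec_zero zero_oplus)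
  also have "\<dots> \<le> oexp \<omega> b * \<omega>"
  proof (rule leI, rule notI)
    assume "oexp \<omega> b * \<omega> < oexp \<omega> b * (osuc ^^ 1) 0"
    then have "oexp \<omega> b * \<omega> < oexp \<omega> b * \<omega>" unfolding less_otimes_omega_iff by blast
    then show False by simp
  qed
  finally show ?thesis by (simp only: oexp_osuc)
qed

lemma oexp_omega_mono:
  fixes a :: "'c ordinal"
  shows "a \<le> b \<Longrightarrow> oexp \<omega> a \<le> oexp \<omega> b"
proof (induction b rule: ordinal_induct)
  case zero
  then show ?case using ordinal_zero_le[of a] by (metis antisym order_refl)
next
  case (osuc b)
  then show ?case
    by (metis oexp_omega_osuc_ge less_osuc_iff order_le_less order_trans)
next
  case (olimit b)
  show ?case
  proof (cases "a = b")
    case False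
    then have "a < b" using olimit.prems by simp
    then show ?thesis
      unfolding oexp_olimit[OF olimit.hyps] by (rule osup_upper)
  qed simp
qed

lemma oexp_omega_pos: "0 < oexp \<omega> (b :: 'c ordinal)"
  using oexp_omega_mono[OF ordinal_zero_le, of b] less_osuc[of "0 :: 'c ordinal"]
  by (simp add: oexp_zero one_ordinal_def)

text \<open>This is the room for the supremum point appended in the successor step. The finite
  multiples of \<open>oexp \<omega> b\<close> strictly increase, so its successor is at most the
  second and hence below the third.\<close>

lemma osuc_oexp_omega_less: "osuc (oexp \<omega> b) < oexp \<omega> (osuc (b :: 'c ordinal))"
proof -
  let ?p = "oexp \<omega> b"
  have p: "1 \<le> ?p" using oexp_omega_mono[OF ordinal_zero_le, of b] by (simp add: oexp_zero)
  have "a < a + ?p" for a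
    using oplus_strict_mono_right[OF oexp_omega_pos, of a b] by (simp add: oplus_zero)
  then have step: "osuc a \<le> a + ?p" for a by (simp add: osuc_le_iff)
  let ?f = "\<lambda>n. ?p * (osuc ^^ n) 0"
  have inc: "?f n < ?f (Suc n)" for n
    using \<open>\<And>a. a < a + ?p\<close> unfolding otimes_funpow_Suc by blast
  have "?p = ?f 1" by (simp add: times_ordinal_def ord_rec_osuc ord_rec_zero zero_oplus)
  then have "?p < ?f 2" using inc[of 1] by (simp add: numeral_2_eq_2)
  then have "osuc ?p < ?f 3" using inc[of 2] by (metis eval_nat_numeral(3) osuc_le_iff order_le_less_trans)
  then show ?thesis unfolding oexp_osuc less_otimes_omega_iff by blast
qed

text \<open>Powers of \<omega> are additively indecomposable, which controls lengths when maps are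
  concatenated. At a successor two finite multiples add up to a finite multiple; at a limit both
  summands lie below a common earlier power.\<close>

lemma oplus_less_oexp_omega:
  fixes a :: "'c ordinal"
  shows "a < oexp \<omega> c \<Longrightarrow> b < oexp \<omega> c \<Longrightarrow> a + b < oexp \<omega> c"
proof (induction c arbitrary: a b rule: ordinal_induct)
  case zero
  then have "a = 0" "b = 0"
    using ordinal_zero_le by (auto simp: oexp_zero one_ordinal_def less_osuc_iff intro: antisym)
  then show ?case using zero by (simp add: oplus_zero)
next
  case (osuc c)
  then obtain m n where "a < oexp \<omega> c * (osuc ^^ m) 0" "b < oexp \<omega> c * (osuc ^^ n) 0"
    by (auto simp: oexp_osuc less_otimes_omega_iff)
  then have "a + b < oexp \<omega> c * (osuc ^^ (m + n)) 0"
    by (metis oplus_strict_mono_both order_less_imp_le otimes_funpow_add)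
  then show ?case by (auto simp: oexp_osuc less_otimes_omega_iff)
next
  case (olimit c)
  then obtain d e where d: "d < c" "a < oexp \<omega> d" and e: "e < c" "b < oexp \<omega> e"
    by (auto simp: oexp_olimit less_osup_image_iff)
  have "max d e < c" "a < oexp \<omega> (max d e)" "b < oexp \<omega> (max d e)"
    using d e oexp_omega_mono[of d "max d e"] oexp_omega_mono[of e "max d e"] by auto
  then have "\<exists>f<c. a + b < oexp \<omega> f" using olimit.IH by blast
  then show ?case using olimit.hyps by (simp add: oexp_olimit less_osup_image_iff)
qed

section \<open>Maps of clopen sets onto ordinals\<close>

definition cylinder :: "nat \<Rightarrow> cantor \<Rightarrow> cantor set"
  where "cylinder n t = {s. \<forall>k<n. s k = t k}"

lemma open_coordinate: "open {t :: cantor. t k = v}"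
proof -
  have "open ((\<lambda>t :: cantor. t k) -` {v})"
    by (rule open_vimage) (auto intro: open_discrete)
  moreover have "(\<lambda>t :: cantor. t k) -` {v} = {t. t k = v}" by auto
  ultimately show ?thesis by simp
qed

lemma open_cylinder: "open (cylinder n t)"
proof -
  have "cylinder n t = (\<Inter>k<n. {s. s k = t k})" by (auto simp: cylinder_def)
  then show ?thesis by (simp add: open_INT open_coordinate)
qed

lemma mem_cylinder: "t \<in> cylinder n t"
  by (simp add: cylinder_def)

lemma cylinder_eq: "s \<in> cylinder n t \<Longrightarrow> cylinder n s = cylinder n t"
  by (auto simp: cylinder_def)

text \<open>The condition depends on the first \<open>n\<close> coordinates only, so its set is a
  union of cylinders of length \<open>n\<close>, and so is the complement. Such sets later exhaust
  an open set by clopen ones.\<close>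

lemma open_cylinder_cond: "open {t. P (cylinder n t)}"
  unfolding open_subopen[of "{t. P (cylinder n t)}"]
  by (metis (mono_tags, lifting) cylinder_eq mem_Collect_eq mem_cylinder open_cylinder subsetI)

lemma closed_cylinder_cond: "closed {t. P (cylinder n t)}"
  unfolding closed_def Collect_neg_eq[symmetric] by (rule open_cylinder_cond)

lemma closed_cylinder: "closed (cylinder n t)"
proof -
  have "cylinder n t = {s. t \<in> cylinder n s}" by (auto simp: cylinder_def)
  then show ?thesis using closed_cylinder_cond[of "\<lambda>A. t \<in> A" n] by simp
qed

text \<open>A basic open set of the product restricts only finitely many coordinates, and a long
  enough initial stretch of \<open>t\<close> settles all of them.\<close>

lemma cylinder_subset_open:
  assumes "open U" "t \<in> U"
  obtains n where "cylinder n t \<subseteq> U"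
proof -
  obtain X where X: "t \<in> Pi\<^sub>E UNIV X" "finite {i. X i \<noteq> UNIV}" "Pi\<^sub>E UNIV X \<subseteq> U"
    using product_topology_open_contains_basis[OF assms(1)[unfolded open_fun_def] assms(2)] by auto
  obtain n where n: "\<forall>i\<in>{i. X i \<noteq> UNIV}. i < n"
    using X(2) finite_nat_set_iff_bounded by blast
  have mem: "s i \<in> X i" if "s \<in> cylinder n t" for s i
  proof (cases "i < n")
    case True
    then have "s i = t i" using that by (simp add: cylinder_def)
    then show ?thesis using PiE_mem[OF X(1)] by simp
  next
    case False
    then show ?thesis using n by auto
  qed
  have "s \<in> Pi\<^sub>E UNIV X" if "s \<in> cylinder n t" for s
    using mem[OF that] unfolding PiE_UNIV_domain by blast
  then have "cylinder n t \<subseteq> U" using X(3) by blast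
  then show thesis by (rule that)
qed

lemma compact_cantor: "compact (UNIV :: cantor set)"
proof -
  have "compact_space (euclidean :: bool topology)"
    by (simp add: compact_space_def finite_imp_compact)
  then have "compact_space (product_topology (\<lambda>_ :: nat. euclidean :: bool topology) UNIV)"
    unfolding compact_space_product_topology by blast
  then show ?thesis
    by (simp add: euclidean_product_topology compact_space_def)
qed

section \<open>Ordinal-valued maps and their concatenation\<close>

text \<open>
  For open \<open>A\<close>, the third conjunct is the continuity of \<open>\<phi>\<close> on \<open>A\<close>, stated with the
  subbasic open rays.
\<close>

definition ordinal_map :: "('t :: topological_space \<Rightarrow> 't \<Rightarrow> bool) \<Rightarrow> 't set \<Rightarrow> 'c ordinal \<Rightarrow>
    ('t \<Rightarrow> 'c ordinal) \<Rightarrow> bool"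
  where "ordinal_map R A a \<phi> \<longleftrightarrow> \<phi> ` A = {..<a} \<and> countable {..<a} \<and>
    (\<forall>m. open {t\<in>A. \<phi> t < m} \<and> open {t\<in>A. m < \<phi> t}) \<and>
    (\<forall>s\<in>A. \<forall>t\<in>A. \<phi> s = \<phi> t \<longrightarrow> R s t)"

text \<open>A threshold \<open>m \<ge> s\<close> is brought back to a threshold for \<phi> by left
  subtraction; one below \<open>s\<close> gives the empty set or all of \<open>A\<close>.\<close>

lemma open_shift:
  assumes "ordinal_map R A a \<phi>" "open A"
  shows "open {t\<in>A. s + \<phi> t < m}" "open {t\<in>A. m < s + \<phi> t}"
proof -
  show "open {t\<in>A. s + \<phi> t < m}"
  proof (cases "s \<le> m")
    case True
    then obtain m' where "m = s + m'" by (rule oplus_diff)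
    then show ?thesis using assms by (simp add: oplus_less_iff ordinal_map_def)
  next
    case False
    then have "\<not> s + \<phi> t < m" for t using le_oplus_left[of s "\<phi> t"] by simp
    then show ?thesis by simp
  qed
  show "open {t\<in>A. m < s + \<phi> t}"
  proof (cases "s \<le> m")
    case True
    then obtain m' where "m = s + m'" by (rule oplus_diff)
    then show ?thesis using assms by (simp add: oplus_less_iff ordinal_map_def)
  next
    case False
    then have "m < s + \<phi> t" for t using le_oplus_left[of s "\<phi> t"] by simp
    then show ?thesis using assms by simp
  qed
qed

lemma countable_lessThan_oplus:
  "countable {..<a} \<Longrightarrow> countable {..<b} \<Longrightarrow> countable {..<a + (b :: 'c ordinal)}"
  by (simp add: lessThan_oplus)

lemma countable_lessThan_osuc:
  "countable {..<a} \<Longrightarrow> countable {..<osuc (a :: 'c ordinal)}"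
proof -
  have "{..<osuc a} = insert a {..<a}" by (auto simp: less_osuc_iff)
  then show "countable {..<a} \<Longrightarrow> countable {..<osuc a}" by simp
qed

lemma ordinal_map_Un:
  assumes A: "ordinal_map R A a \<phi>" "open A" and B: "ordinal_map R B b \<psi>" "open B"
    and disj: "A \<inter> B = {}"
  shows "ordinal_map R (A \<union> B) (a + b) (\<lambda>t. if t \<in> A then \<phi> t else a + \<psi> t)"
    (is "ordinal_map R _ _ ?\<chi>")
proof -
  have chiB: "?\<chi> t = a + \<psi> t" if "t \<in> B" for t using disj that by auto
  have small: "?\<chi> t < a" if "t \<in> A" for t using A(1) that by (auto simp: ordinal_map_def)
  have large: "a \<le> ?\<chi> t" if "t \<in> B" for t using that by (simp only: chiB le_oplus_left)
  have "?\<chi> ` (A \<union> B) = \<phi> ` A \<union> (+) a ` \<psi> ` B"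
    unfolding image_Un image_image by (intro arg_cong2[where f = "(\<union>)"] image_cong) (auto simp: chiB)
  also have "\<dots> = {..<a + b}" using A(1) B(1) by (simp add: ordinal_map_def lessThan_oplus)
  finally have img: "?\<chi> ` (A \<union> B) = {..<a + b}" .
  have "open {t \<in> A \<union> B. ?\<chi> t < m}" for m
  proof -
    have "{t \<in> A \<union> B. ?\<chi> t < m} = {t\<in>A. \<phi> t < m} \<union> {t\<in>B. a + \<psi> t < m}" using disj by auto
    then show ?thesis using A open_shift[OF B] by (simp add: ordinal_map_def open_Un)
  qed
  moreover have "open {t \<in> A \<union> B. m < ?\<chi> t}" for m
  proof -
    have "{t \<in> A \<union> B. m < ?\<chi> t} = {t\<in>A. m < \<phi> t} \<union> {t\<in>B. m < a + \<psi> t}" using disj by auto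
    then show ?thesis using A open_shift[OF B] by (simp add: ordinal_map_def open_Un)
  qed
  moreover have "R s t" if st: "s \<in> A \<union> B" "t \<in> A \<union> B" "?\<chi> s = ?\<chi> t" for s t
  proof -
    \<comment> \<open>Values on \<open>A\<close> lie below \<open>a\<close> and values on
      \<open>B\<close> do not, so a fibre never meets both.\<close>
    have "s \<in> A \<longleftrightarrow> t \<in> A" using st small large by (metis UnE not_le)
    then show ?thesis using st A B by (auto simp: ordinal_map_def oplus_eq_iff split: if_splits)
  qed
  moreover have "countable {..<a + b}"
    using A(1) B(1) by (simp add: ordinal_map_def countable_lessThan_oplus)
  ultimately show ?thesis using img by (simp add: ordinal_map_def)
qed

definition resolvable :: "('t :: topological_space \<Rightarrow> 't \<Rightarrow> bool) \<Rightarrow> 't set \<Rightarrow> 'c ordinal \<Rightarrow> bool"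
  where "resolvable R A g \<longleftrightarrow> (\<exists>a<g. \<exists>\<phi>. ordinal_map R A a \<phi>)"

lemma resolvable_empty:
  fixes g :: "'c ordinal"
  assumes "0 < g"
  shows "resolvable R {} g"
proof -
  have "{..<0} = ({} :: 'c ordinal set)" by (auto simp: ordinal_not_less_zero)
  then show ?thesis
    using assms unfolding resolvable_def ordinal_map_def by (intro exI[of _ 0]) simp
qed

lemma resolvable_mono: "resolvable R A g \<Longrightarrow> g \<le> h \<Longrightarrow> resolvable R A h"
  unfolding resolvable_def by (meson order_less_le_trans)

lemma resolvable_Un:
  assumes "resolvable R A (oexp \<omega> c)" "open A" "resolvable R B (oexp \<omega> c)" "open B" "A \<inter> B = {}"
  shows "resolvable R (A \<union> B) (oexp \<omega> c)"
proof -
  obtain a \<phi> where "a < oexp \<omega> c" "ordinal_map R A a \<phi>" using assms(1) by (auto simp: resolvable_def)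
  moreover obtain d \<psi> where "d < oexp \<omega> c" "ordinal_map R B d \<psi>" using assms(3) by (auto simp: resolvable_def)
  ultimately show ?thesis
    using ordinal_map_Un[of R A a \<phi> B d \<psi>] oplus_less_oexp_omega[of a c d] assms(2,4,5)
    unfolding resolvable_def by blast
qed

text \<open>Members of the cover are peeled off one at a time, splitting \<open>A\<close> into the
  disjoint clopen sets \<open>A \<inter> U\<close> and \<open>A - U\<close>. The last hypothesis
  speaks of all clopen subsets so that it passes to \<open>A - U\<close>.\<close>

lemma resolvable_finite_cover:
  assumes "finite \<U>" and "A \<subseteq> \<Union>\<U>" and "open A" "closed A"
    and "\<And>U. U \<in> \<U> \<Longrightarrow> open U \<and> closed U"
    and "\<And>U B. U \<in> \<U> \<Longrightarrow> open B \<Longrightarrow> closed B \<Longrightarrow> B \<subseteq> U \<Longrightarrow> B \<subseteq> A \<Longrightarrow> resolvable R B (oexp \<omega> c)"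
  shows "resolvable R A (oexp \<omega> c)"
  using assms
proof (induction \<U> arbitrary: A rule: finite_induct)
  case empty
  then show ?case by (simp add: resolvable_empty oexp_omega_pos)
next
  case (insert U \<U>)
  have U: "open U" "closed U" using insert.prems by auto
  have "resolvable R (A \<inter> U) (oexp \<omega> c)"
    by (rule insert.prems(5)[of U]) (use insert.prems U in auto)
  moreover have "resolvable R (A - U) (oexp \<omega> c)"
  proof (rule insert.IH)
    show "resolvable R B (oexp \<omega> c)" if "V \<in> \<U>" "open B" "closed B" "B \<subseteq> V" "B \<subseteq> A - U" for V B
      using insert.prems(5)[of V B] that by blast
  qed (use insert.prems U in auto)
  ultimately have "resolvable R ((A \<inter> U) \<union> (A - U)) (oexp \<omega> c)"
    by (intro resolvable_Un) (use insert.prems U in \<open>auto intro: open_Diff\<close>)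
  moreover have "(A \<inter> U) \<union> (A - U) = A" by blast
  ultimately show ?case by simp
qed

text \<open>
  Shifting the maps of a sequence of clopen sets that exhausts the complement of \<open>C\<close> and
  sending \<open>C\<close> to the supremum of the shifts is continuous, because every neighbourhood of the
  supremum contains all but finitely many of the shifted intervals.
\<close>

lemma resolvable_one_point_extension:
  fixes W :: "nat \<Rightarrow> 't :: topological_space set" and b :: "'c ordinal"
  assumes W: "\<And>n. open (W n)" "\<And>n. closed (W n)" "A - C = (\<Union>n. W n)"
    and A: "open A" "closed A" and C: "C \<subseteq> A" "\<And>s t. s \<in> C \<Longrightarrow> t \<in> C \<Longrightarrow> R s t"
    and res: "\<And>B. open B \<Longrightarrow> closed B \<Longrightarrow> B \<subseteq> A - C \<Longrightarrow> resolvable R B (oexp \<omega> b)"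
  shows "resolvable R A (oexp \<omega> (osuc b))"
proof (cases "C = {}")
  case True
  then have "resolvable R A (oexp \<omega> b)" using res A by simp
  then show ?thesis using oexp_omega_osuc_ge by (rule resolvable_mono)
next
  case False
  \<comment> \<open>Removing the finitely many earlier sets makes the pieces disjoint and keeps them
    clopen. \<open>N t\<close> is then the index of the piece containing \<open>t\<close>.\<close>
  define V where "V n = W n - (\<Union>k<n. W k)" for n
  have V: "open (V n)" "closed (V n)" "V n \<subseteq> A - C" for n
    using W by (auto simp: V_def intro!: open_Diff closed_Diff closed_UN open_UN)
  have V_disj: "m = n" if "t \<in> V m" "t \<in> V n" for t m n
    using that by (cases m n rule: linorder_cases) (auto simp: V_def)
  define N where "N t = (LEAST n. t \<in> W n)" for t
  have N: "t \<in> V n \<longleftrightarrow> N t = n" if "t \<in> A - C" for t n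
  proof -
    have "\<exists>n. t \<in> W n" using that W(3) by auto
    then have "t \<in> W (N t)" unfolding N_def by (rule LeastI_ex)
    then have "t \<in> V (N t)" unfolding V_def N_def by (auto dest: not_less_Least)
    then show ?thesis using V_disj by blast
  qed
  have "\<forall>n. \<exists>a \<phi>. a < oexp \<omega> b \<and> ordinal_map R (V n) a \<phi>"
    using res[OF V] unfolding resolvable_def by blast
  then obtain a \<phi> where a: "\<And>n. a n < oexp \<omega> b" and \<phi>: "\<And>n. ordinal_map R (V n) (a n) (\<phi> n)"
    by metis
  \<comment> \<open>The map on \<open>V n\<close> is shifted by \<open>s n\<close>, the sum of the
    preceding lengths. Additive indecomposability keeps every \<open>s n\<close> below
    \<open>oexp \<omega> b\<close>.\<close>
  define s where "s = rec_nat 0 (\<lambda>n x. x + a n)"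
  have s_simps: "s 0 = 0" "s (Suc n) = s n + a n" for n by (simp_all add: s_def)
  have s_less: "s n < oexp \<omega> b" for n
    by (induction n) (simp_all add: s_simps oexp_omega_pos oplus_less_oexp_omega a)
  have s_mono: "mono s" by (rule mono_iff_le_Suc[THEN iffD2]) (simp add: s_simps le_oplus_left)
  have s_count: "countable {..<s n}" for n
  proof (induction n)
    case 0
    have "{..<0} = ({} :: 'c ordinal set)" by (auto simp: ordinal_not_less_zero)
    then show ?case by (simp add: s_simps)
  next
    case (Suc n)
    then show ?case using \<phi>[of n] by (simp add: s_simps countable_lessThan_oplus ordinal_map_def)
  qed
  \<comment> \<open>The value given to \<open>C\<close> is the least upper bound of the shifts. It
    exists because they are bounded by \<open>oexp \<omega> b\<close>, and it may equal that
    bound.\<close>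
  define S where "S = (LEAST u. \<forall>n. s n \<le> u)"
  have ub: "\<forall>n. s n \<le> oexp \<omega> b" using s_less order_less_imp_le by blast
  have s_le: "s n \<le> S" for n using LeastI[of "\<lambda>u. \<forall>n. s n \<le> u", OF ub] by (simp add: S_def)
  have S_le: "S \<le> oexp \<omega> b" unfolding S_def using ub by (rule Least_le)
  have less_S: "m < S \<longleftrightarrow> (\<exists>n. m < s n)" for m
    using not_less_Least[of m "\<lambda>u. \<forall>n. s n \<le> u"] s_le unfolding S_def[symmetric]
    by (meson not_le order_less_le_trans)
  define \<psi> where "\<psi> t = (if t \<in> C then S else s (N t) + \<phi> (N t) t)" for t
  have \<psi>V: "\<psi> t = s n + \<phi> n t" if "t \<in> V n" for t n
    using N[of t n] V(3)[of n] that by (auto simp: \<psi>_def)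
  have \<psi>_range: "s n \<le> \<psi> t \<and> \<psi> t < s (Suc n)" if "t \<in> V n" for t n
    using \<phi>[of n] that by (auto simp: \<psi>V le_oplus_left s_simps oplus_less_iff ordinal_map_def)
  have A_eq: "A = C \<union> (\<Union>n. V n)" using C(1) N V(3) by blast
  have img_V: "\<psi> ` V n = (+) (s n) ` {..<a n}" for n
  proof -
    have "\<psi> ` V n = (+) (s n) ` \<phi> n ` V n" unfolding image_image by (intro image_cong) (auto simp: \<psi>V)
    then show ?thesis using \<phi>[of n] by (simp add: ordinal_map_def)
  qed
  have lessThan_s: "{..<s n} \<subseteq> (\<Union>k. \<psi> ` V k)" for n
  proof (induction n)
    case 0
    then show ?case by (auto simp: s_simps ordinal_not_less_zero)
  next
    case (Suc n)
    then show ?case unfolding s_simps lessThan_oplus using img_V[of n] by blast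
  qed
  have \<psi>_less: "\<psi> t < S" if "t \<in> V n" for t n
    using \<psi>_range[OF that] s_le[of "Suc n"] by (meson order_less_le_trans)
  have "(\<Union>n. \<psi> ` V n) = {..<S}"
  proof
    show "(\<Union>n. \<psi> ` V n) \<subseteq> {..<S}" using \<psi>_less by auto
    show "{..<S} \<subseteq> (\<Union>n. \<psi> ` V n)"
    proof
      fix m assume "m \<in> {..<S}"
      then obtain n where "m \<in> {..<s n}" unfolding lessThan_iff less_S ..
      then show "m \<in> (\<Union>n. \<psi> ` V n)" using lessThan_s[of n] by (rule rev_subsetD)
    qed
  qed
  moreover have "\<psi> ` C = {S}" using False by (auto simp: \<psi>_def)
  ultimately have img: "\<psi> ` A = {..<osuc S}"
    unfolding A_eq image_Un image_UN by (auto simp: less_osuc_iff)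
  have \<psi>_le: "\<psi> t \<le> S" if "t \<in> A" for t
    using imageI[OF that, of \<psi>] unfolding img by (simp add: less_osuc_iff)
  have "{..<S} = (\<Union>n. {..<s n})" using less_S by auto
  then have count: "countable {..<osuc S}"
    using s_count by (intro countable_lessThan_osuc) simp
  have opV: "open {t \<in> V n. \<psi> t < m}" "open {t \<in> V n. m < \<psi> t}" for n m
  proof -
    have "{t \<in> V n. \<psi> t < m} = {t \<in> V n. s n + \<phi> n t < m}"
      "{t \<in> V n. m < \<psi> t} = {t \<in> V n. m < s n + \<phi> n t}" by (auto simp: \<psi>V)
    then show "open {t \<in> V n. \<psi> t < m}" "open {t \<in> V n. m < \<psi> t}"
      using open_shift[OF \<phi> V(1)] by simp_all
  qed
  have lower: "open {t \<in> A. \<psi> t < m}" for m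
  proof (cases "S < m")
    case True
    then have "{t \<in> A. \<psi> t < m} = A" using \<psi>_le by (auto intro: order_le_less_trans)
    then show ?thesis using A by simp
  next
    case False
    \<comment> \<open>For \<open>m \<le> S\<close> no point of \<open>C\<close> qualifies, so the
      set is assembled from the pieces alone.\<close>
    then have "{t \<in> A. \<psi> t < m} = (\<Union>n. {t \<in> V n. \<psi> t < m})" unfolding A_eq by (auto simp: \<psi>_def)
    then show ?thesis using opV by (simp add: open_UN)
  qed
  have upper: "open {t \<in> A. m < \<psi> t}" for m
  proof (cases "m < S")
    case True
    then obtain n where n: "m < s n" using less_S by blast
    have "t \<in> V k \<Longrightarrow> n \<le> k \<Longrightarrow> m < \<psi> t" for t k
      using n \<psi>_range[of t k] monoD[OF s_mono, of n k] by (meson order_less_le_trans)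
    moreover have "\<psi> t = S" if "t \<in> C" for t using that by (simp add: \<psi>_def)
    ultimately have tail: "m < \<psi> t" if "t \<in> A - (\<Union>k<n. V k)" for t
      using that True unfolding A_eq by (metis DiffE UN_iff Un_iff lessThan_iff not_le)
    have "V k \<subseteq> A" for k using V(3) by blast
    \<comment> \<open>Removing finitely many closed pieces leaves an open set around
      \<open>C\<close> on which \<psi> exceeds \<open>m\<close>; the other points are collected
      piece by piece.\<close>
    then have "{t \<in> A. m < \<psi> t} = (A - (\<Union>k<n. V k)) \<union> (\<Union>k. {t \<in> V k. m < \<psi> t})"
      using tail by blast
    moreover have "open (A - (\<Union>k<n. V k))" using V A by (intro open_Diff closed_UN) auto
    ultimately show ?thesis using opV by (simp add: open_Un open_UN)
  next
    case False
    then have "{t \<in> A. m < \<psi> t} = {}" using \<psi>_le by (auto dest: order_less_le_trans)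
    then show ?thesis by (simp only: open_empty)
  qed
  have "R t t'" if t: "t \<in> A" "t' \<in> A" "\<psi> t = \<psi> t'" for t t'
  proof (cases "t \<in> C")
    case True
    then have "\<psi> t' = S" using t by (simp add: \<psi>_def)
    \<comment> \<open>Values on the pieces are strictly below \<open>S\<close>, so the fibre over
      \<open>S\<close> is \<open>C\<close> itself.\<close>
    then have "t' \<in> C" using \<psi>_less t(2) unfolding A_eq by force
    then show ?thesis using True C(2) by blast
  next
    case False
    then obtain n where n: "t \<in> V n" using t(1) unfolding A_eq by blast
    then have "\<psi> t' < S" using \<psi>_less t(3) by metis
    then have "t' \<notin> C" by (auto simp: \<psi>_def)
    then obtain n' where n': "t' \<in> V n'" using t(2) unfolding A_eq by blast
    \<comment> \<open>The half-open intervals from \<open>s n\<close> to \<open>s (Suc n)\<close>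
      are disjoint, so equal values come from the same piece.\<close>
    have "n = n'"
    proof (rule ccontr)
      assume "n \<noteq> n'"
      then consider "Suc n \<le> n'" | "Suc n' \<le> n" by linarith
      then show False
        by cases (use t(3) \<psi>_range[OF n] \<psi>_range[OF n'] monoD[OF s_mono] in
          \<open>metis order_less_le_trans order_less_irrefl order_le_less_trans\<close>)+
    qed
    then have "\<phi> n t = \<phi> n t'" using t(3) n n' by (simp add: \<psi>V oplus_eq_iff)
    then show ?thesis using \<phi>[of n] n n' \<open>n = n'\<close> by (auto simp: ordinal_map_def)
  qed
  then have "ordinal_map R A (osuc S) \<psi>"
    using img count lower upper by (simp add: ordinal_map_def)
  moreover have "osuc S < oexp \<omega> (osuc b)"
    using S_le osuc_oexp_omega_less[of b] by (metis osuc_mono_iff order_le_less order_less_trans)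
  ultimately show ?thesis unfolding resolvable_def by blast
qed

section \<open>Derivations and spaces of continuous functions\<close>

text \<open>Each derivation costs one exponent: what a small clopen set retains of
  \<open>E b\<close> collapses to a single point, appended after countably many maps of lengths
  below \<open>oexp \<omega> b\<close>. Keeping \<open>E\<close> abstract separates this induction
  from the weak-star topology.\<close>

lemma resolvable_derived_empty:
  fixes E :: "'c ordinal \<Rightarrow> cantor set"
  assumes E_closed: "\<And>b. closed (E b)" and E_zero: "E 0 = UNIV"
    and E_olimit: "\<And>b. olimit b \<Longrightarrow> E b = (\<Inter>c<b. E c)"
    and E_antimono: "\<And>b c. b \<le> c \<Longrightarrow> E c \<subseteq> E b"
    and E_osuc: "\<And>b t. t \<in> E b \<Longrightarrow> t \<notin> E (osuc b) \<Longrightarrow>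
      \<exists>U. open U \<and> t \<in> U \<and> (\<forall>s\<in>U \<inter> E b. \<forall>s'\<in>U \<inter> E b. R s s')"
  shows "open A \<Longrightarrow> closed A \<Longrightarrow> A \<inter> E b = {} \<Longrightarrow> resolvable R A (oexp \<omega> b)"
proof (induction b arbitrary: A rule: ordinal_induct)
  case zero
  then show ?case by (simp add: E_zero resolvable_empty oexp_omega_pos)
next
  case (osuc b)
  have cA: "compact A" using compact_Int_closed[OF compact_cantor osuc.prems(2)] by simp
  have "\<exists>n. \<forall>s\<in>cylinder n t \<inter> E b. \<forall>s'\<in>cylinder n t \<inter> E b. R s s'" if "t \<in> A" for t
  proof (cases "t \<in> E b")
    case True
    have "t \<notin> E (osuc b)" using that osuc.prems(3) by blast
    then obtain U where U: "open U" "t \<in> U" "\<forall>s\<in>U \<inter> E b. \<forall>s'\<in>U \<inter> E b. R s s'"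
      using E_osuc[OF True] by metis
    obtain n where "cylinder n t \<subseteq> U" using U(1,2) by (rule cylinder_subset_open)
    then show ?thesis using U(3) by (intro exI[of _ n]) blast
  next
    case False
    \<comment> \<open>Off the closed set \<open>E b\<close>, a cylinder missing it makes the
      condition vacuous.\<close>
    obtain n where "cylinder n t \<subseteq> - E b"
      using False E_closed[of b] by (auto intro: cylinder_subset_open[of "- E b" t])
    then show ?thesis by blast
  qed
  then obtain n where n: "\<And>t. t \<in> A \<Longrightarrow>
      \<forall>s\<in>cylinder (n t) t \<inter> E b. \<forall>s'\<in>cylinder (n t) t \<inter> E b. R s s'" by metis
  obtain T where T: "T \<subseteq> A" "finite T" "A \<subseteq> (\<Union>t\<in>T. cylinder (n t) t)"
  proof (rule compactE_image[OF cA, of A "\<lambda>t. cylinder (n t) t"])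
    show "A \<subseteq> (\<Union>t\<in>A. cylinder (n t) t)" using mem_cylinder by blast
  qed (rule open_cylinder)
  show ?case
  proof (rule resolvable_finite_cover[of "(\<lambda>t. cylinder (n t) t) ` T"])
    fix U B
    assume "U \<in> (\<lambda>t. cylinder (n t) t) ` T" and B: "open B" "closed B" "B \<subseteq> U" "B \<subseteq> A"
    then obtain t where t: "t \<in> A" "B \<subseteq> cylinder (n t) t" using T(1) by blast
    show "resolvable R B (oexp \<omega> (osuc b))"
    proof (rule resolvable_one_point_extension)
      \<comment> \<open>The role of \<open>C\<close> is played by \<open>B \<inter> E b\<close>, and
        \<open>W n\<close> consists of the points whose cylinder of length \<open>n\<close> stays
        inside the open set \<open>B - E b\<close>.\<close>
      show "open {t. cylinder n t \<subseteq> B - E b}" "closed {t. cylinder n t \<subseteq> B - E b}" for n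
        by (rule open_cylinder_cond closed_cylinder_cond)+
      have "\<exists>n. cylinder n s \<subseteq> B - E b" if "s \<in> B - E b" for s
        using cylinder_subset_open[OF open_Diff[OF B(1) E_closed] that] by blast
      moreover have "s \<in> B - E b" if "cylinder n s \<subseteq> B - E b" for n s
        using mem_cylinder that by (rule rev_subsetD)
      ultimately have "s \<in> B - E b \<longleftrightarrow> (\<exists>n. cylinder n s \<subseteq> B - E b)" for s by metis
      then show "B - B \<inter> E b = (\<Union>n. {t. cylinder n t \<subseteq> B - E b})" by auto
      show "R s s'" if "s \<in> B \<inter> E b" "s' \<in> B \<inter> E b" for s s'
        using n[OF t(1)] t(2) that by blast
      show "resolvable R B' (oexp \<omega> b)" if "open B'" "closed B'" "B' \<subseteq> B - B \<inter> E b" for B'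
        using osuc.IH[OF that(1,2)] that(3) by blast
    qed (use B in auto)
  qed (use T osuc.prems in \<open>auto simp: open_cylinder closed_cylinder\<close>)
next
  case (olimit b)
  \<comment> \<open>By compactness finitely many \<open>E c\<close> already have no common point in
    \<open>A\<close>. As the sets decrease, the largest index alone suffices; if there is no index,
    \<open>A\<close> is empty and 0 serves.\<close>
  have "compact A" using compact_Int_closed[OF compact_cantor olimit.prems(2)] by simp
  moreover have "A \<inter> (\<Inter>c\<in>{..<b}. E c) = {}"
    using olimit.prems(3) E_olimit[OF olimit.hyps] by simp
  ultimately obtain I where I: "finite I" "I \<subseteq> {..<b}" "A \<inter> (\<Inter>c\<in>I. E c) = {}"
    using compact_imp_fip_image[of A "{..<b}" E] E_closed by blast
  obtain c where c: "c < b" "A \<inter> E c = {}"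
  proof (cases "I = {}")
    case True
    then have "A = {}" using I by simp
    moreover have "0 < b" using olimit.hyps ordinal_zero_le[of b] by (auto simp: olimit_def order_less_le)
    ultimately show thesis using that by blast
  next
    case False
    have "E (Max I) \<subseteq> E c" if "c \<in> I" for c using that I(1) by (intro E_antimono Max_ge)
    moreover have "Max I \<in> I" using I(1) False by (rule Max_in)
    ultimately have "Max I \<in> I" "E (Max I) \<subseteq> (\<Inter>c\<in>I. E c)" by blast+
    then show thesis using I(2,3) that[of "Max I"] by blast
  qed
  have "resolvable R A (oexp \<omega> c)" using olimit.IH[OF c(1)] olimit.prems c(2) by blast
  then show ?case by (rule resolvable_mono) (simp add: oexp_omega_mono order_less_imp_le c)
qed

section \<open>Approximation by functions constant on fibres\<close>

lemma ordinal_map_continuous: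
  assumes "ordinal_map R UNIV a \<phi>"
  shows "continuous_on UNIV \<phi>"
proof (rule continuous_on_generate_topology[OF open_ordinal_def])
  fix B :: "'b ordinal set"
  assume "B \<in> range (\<lambda>a. {..<a}) \<union> range (\<lambda>a. {a<..})"
  then have "open (\<phi> -` B)"
    using assms by (auto simp: ordinal_map_def vimage_def)
  then show "\<exists>C. open C \<and> C \<inter> UNIV = \<phi> -` B \<inter> UNIV" by blast
qed

text \<open>Induction on \<open>l\<close> treats the points sent to values up to \<open>l\<close>.
  Each step puts one constant on a final clopen interval of \<open>{0..l}\<close> and leaves the
  rest to the induction hypothesis.\<close>

lemma cont_functions_approx:
  fixes g :: "'t :: topological_space \<Rightarrow> real" and \<phi> :: "'t \<Rightarrow> 'c ordinal"
  assumes cpt: "compact (UNIV :: 't set)" and g: "continuous_on UNIV g" and \<phi>: "continuous_on UNIV \<phi>"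
    and osc: "\<And>s t. \<phi> s = \<phi> t \<Longrightarrow> \<bar>g s - g t\<bar> < e" and rng: "range \<phi> = {0..a}"
  shows "\<exists>f\<in>cont_functions {0..a}. \<forall>t. \<bar>g t - f (\<phi> t)\<bar> \<le> e"
proof -
  have "l \<le> a \<Longrightarrow> \<exists>f. continuous_on {0..l} f \<and> (\<forall>t. \<phi> t \<le> l \<longrightarrow> \<bar>g t - f (\<phi> t)\<bar> \<le> e)" for l
  proof (induction l rule: less_induct)
    case (less l)
    then have "l \<in> range \<phi>" using rng ordinal_zero_le by simp
    then obtain t0 where t0: "\<phi> t0 = l" by auto
    \<comment> \<open>The constant \<open>g t0\<close> may fail only on \<open>K\<close>. This set
      is compact, so unless it is empty its image has a maximum \<open>m\<close>.\<close>
    define K where "K = {t. \<phi> t \<le> l \<and> e \<le> \<bar>g t - g t0\<bar>}"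
    have "closed {t. \<phi> t \<le> l}" "closed {t. e \<le> \<bar>g t - g t0\<bar>}"
      by (intro closed_Collect_le continuous_intros \<phi> g)+
    then have "closed K" unfolding K_def by (simp add: closed_Collect_conj)
    then have "compact K" using compact_Int_closed[OF cpt] by simp
    show ?case
    proof (cases "K = {}")
      case True
      then have "\<forall>t. \<phi> t \<le> l \<longrightarrow> \<bar>g t - g t0\<bar> \<le> e" by (auto simp: K_def)
      then show ?thesis by (intro exI[of _ "\<lambda>_. g t0"]) simp
    next
      case False
      have "compact (\<phi> ` K)"
        using \<phi> \<open>compact K\<close> by (metis compact_continuous_image continuous_on_subset subset_UNIV)
      then obtain m where m: "m \<in> \<phi> ` K" "\<forall>x\<in>\<phi> ` K. x \<le> m"
        using compact_attains_sup False by (metis image_is_empty)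
      \<comment> \<open>The value \<open>l\<close> is not taken on \<open>K\<close>, because
        \<open>g\<close> oscillates by less than \<open>e\<close> on the fibre of
        \<open>t0\<close>.\<close>
      have "m < l" using m(1) osc t0 by (fastforce simp: K_def order_less_le)
      then obtain f where f: "continuous_on {0..m} f" "\<forall>t. \<phi> t \<le> m \<longrightarrow> \<bar>g t - f (\<phi> t)\<bar> \<le> e"
        using less.IH[of m] order_trans[OF order_less_imp_le less.prems] by blast
      \<comment> \<open>The jump after \<open>m\<close> does not harm continuity:
        \<open>x \<le> m\<close> is the same as \<open>x < osuc m\<close>, so both sides are
        open.\<close>
      define h where "h x = (if x \<le> m then f x else g t0)" for x
      have "continuous_on ({x. x < osuc m} \<inter> {0..l} \<union> {x. m < x} \<inter> {0..l}) h"
      proof (rule continuous_on_Un_local_open)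
        show "continuous_on ({x. x < osuc m} \<inter> {0..l}) h"
          by (rule continuous_on_cong[THEN iffD2, OF refl _ continuous_on_subset[OF f(1)]])
            (auto simp: h_def less_osuc_iff)
        show "continuous_on ({x. m < x} \<inter> {0..l}) h"
          by (rule continuous_on_cong[THEN iffD2, OF refl _ continuous_on_const[of _ "g t0"]])
            (auto simp: h_def)
      next
        let ?D = "{x. x < osuc m} \<inter> {0..l} \<union> {x. m < x} \<inter> {0..l}"
        show "openin (top_of_set ?D) ({x. x < osuc m} \<inter> {0..l})"
          unfolding openin_open
          by (intro exI[of _ "{..<osuc m}"]) (auto simp: less_osuc_iff)
        show "openin (top_of_set ?D) ({x. m < x} \<inter> {0..l})"
          unfolding openin_open by (intro exI[of _ "{m<..}"]) auto
      qed
      moreover have "{x. x < osuc m} \<inter> {0..l} \<union> {x. m < x} \<inter> {0..l} = {0..l}"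
        by (auto simp: less_osuc_iff)
      ultimately have "continuous_on {0..l} h" by simp
      moreover have "\<bar>g t - h (\<phi> t)\<bar> \<le> e" if "\<phi> t \<le> l" for t
      proof (cases "\<phi> t \<le> m")
        case True
        then show ?thesis using f(2) by (simp add: h_def)
      next
        case False
        then have "t \<notin> K" using m(2) by blast
        then show ?thesis using that False by (auto simp: h_def K_def)
      qed
      ultimately show ?thesis by blast
    qed
  qed
  then obtain f where f: "continuous_on {0..a} f" "\<forall>t. \<phi> t \<le> a \<longrightarrow> \<bar>g t - f (\<phi> t)\<bar> \<le> e" by blast
  \<comment> \<open>Elements of \<open>cont_functions\<close> have to vanish outside the
    interval.\<close>
  define h where "h x = (if x \<in> {0..a} then f x else 0)" for x
  have "continuous_on {0..a} h"
    by (rule continuous_on_cong[THEN iffD2, OF refl _ f(1)]) (simp add: h_def)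
  then have "h \<in> cont_functions {0..a}" by (simp add: cont_functions_def h_def)
  moreover have "\<phi> t \<in> {0..a}" for t using rng by blast
  then have "\<forall>t. \<bar>g t - h (\<phi> t)\<bar> \<le> e" using f(2) by (simp add: h_def)
  ultimately show ?thesis by blast
qed

section \<open>Copies of C(K) obtained from continuous surjections\<close>

lemma cont_functions_add:
  "f \<in> cont_functions K \<Longrightarrow> g \<in> cont_functions K \<Longrightarrow> (\<lambda>x. f x + g x) \<in> cont_functions K"
  by (auto simp: cont_functions_def intro: continuous_on_add)

lemma cont_functions_scale:
  "f \<in> cont_functions K \<Longrightarrow> (\<lambda>x. c * f x) \<in> cont_functions K"
  by (auto simp: cont_functions_def intro: continuous_on_mult_left)

context
  fixes \<phi> :: "'t :: topological_space \<Rightarrow> 'k :: topological_space"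
  assumes cpt: "compact (UNIV :: 't set)" and \<phi>: "continuous_on UNIV \<phi>"
begin

lemma bcontfun_compose:
  "f \<in> cont_functions (range \<phi>) \<Longrightarrow> apply_bcontfun (Bcontfun (f \<circ> \<phi>)) = f \<circ> \<phi>"
proof (rule Bcontfun_inverse)
  assume "f \<in> cont_functions (range \<phi>)"
  then have cont: "continuous_on UNIV (f \<circ> \<phi>)"
    by (intro continuous_on_compose \<phi>) (simp add: cont_functions_def)
  moreover have "bounded (range (f \<circ> \<phi>))"
    using compact_continuous_image[OF cont cpt] by (rule compact_imp_bounded)
  ultimately show "f \<circ> \<phi> \<in> bcontfun" by (simp add: bcontfun_def)
qed

text \<open>Since \<phi> is onto its range, \<open>f\<close> and \<open>f \<circ> \<phi>\<close>
  take the same values there, so composition keeps the supremum norm.\<close>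

lemma isometrically_isomorphic_C_compose:
  defines "Y \<equiv> (\<lambda>f. Bcontfun (f \<circ> \<phi>)) ` cont_functions (range \<phi>)"
  shows "subspace Y" "isometrically_isomorphic_C Y (range \<phi>)"
proof -
  let ?T = "\<lambda>f :: 'k \<Rightarrow> real. Bcontfun (f \<circ> \<phi>)" and ?C = "cont_functions (range \<phi>)"
  have zero: "(\<lambda>_. 0) \<in> ?C" by (simp add: cont_functions_def)
  have add: "?T (\<lambda>x. f x + g x) = ?T f + ?T g" if "f \<in> ?C" "g \<in> ?C" for f g
    by (rule bcontfun_eqI) (simp add: bcontfun_compose that cont_functions_add)
  have scale: "?T (\<lambda>x. c * f x) = c *\<^sub>R ?T f" if "f \<in> ?C" for f c
    by (rule bcontfun_eqI) (simp add: bcontfun_compose that cont_functions_scale)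
  have inj: "inj_on ?T ?C"
  proof (rule inj_onI)
    fix f g assume fg: "f \<in> ?C" "g \<in> ?C" "?T f = ?T g"
    then have eq: "f \<circ> \<phi> = g \<circ> \<phi>" by (metis bcontfun_compose)
    show "f = g"
    proof
      \<comment> \<open>On the range the compositions determine the values; elsewhere both functions
        are 0.\<close>
      fix x show "f x = g x"
        using fg(1,2) fun_cong[OF eq] by (cases "x \<in> range \<phi>") (auto simp: cont_functions_def)
    qed
  qed
  have norm: "norm (?T f) = sup_norm (range \<phi>) f" if "f \<in> ?C" for f
    by (simp add: norm_bcontfun_def dist_bcontfun_def sup_norm_def bcontfun_compose that dist_real_def
        image_image)
  show "isometrically_isomorphic_C Y (range \<phi>)"
    unfolding isometrically_isomorphic_C_def Y_def
    using inj add scale norm by (intro exI[of _ ?T]) (auto simp: bij_betw_def)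
  show "subspace Y"
    unfolding subspace_def Y_def
  proof (intro conjI ballI allI)
    have "?T (\<lambda>_. 0) = 0" by (rule bcontfun_eqI) (subst bcontfun_compose[OF zero], simp)
    then show "0 \<in> ?T ` ?C" using zero by (metis imageI)
    show "x + y \<in> ?T ` ?C" if "x \<in> ?T ` ?C" "y \<in> ?T ` ?C" for x y
      using that add cont_functions_add by (smt (verit) imageE imageI)
    show "c *\<^sub>R x \<in> ?T ` ?C" if "x \<in> ?T ` ?C" for c x
      using that scale cont_functions_scale by (smt (verit) imageE imageI)
  qed
qed

end

section \<open>The weak-star topology and the Szlenk index\<close>

text \<open>This is the Banach-Alaoglu theorem: evaluation identifies the ball with the linear
  functions in a product of compact intervals, and linearity is closed under pointwise
  convergence.\<close>

lemma compactin_dual_cball: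
  assumes "0 \<le> r"
  shows "compactin strong_operator_topology (cball (0 :: 'x :: real_normed_vector \<Rightarrow>\<^sub>L real) r)"
proof -
  let ?P = "product_topology (\<lambda>_ :: 'x. euclidean :: real topology) UNIV"
  let ?B = "cball (0 :: 'x \<Rightarrow>\<^sub>L real) r" and ?b = "blinfun_apply :: ('x \<Rightarrow>\<^sub>L real) \<Rightarrow> _"
  define K where "K = (\<Pi>\<^sub>E x\<in>UNIV. cball (0 :: real) (r * norm (x :: 'x)))"
  define L where "L = (\<Inter>x y. {f :: 'x \<Rightarrow> real. f (x + y) = f x + f y})
    \<inter> (\<Inter>c x. {f :: 'x \<Rightarrow> real. f (c *\<^sub>R x) = c * f x})"
  have "compactin ?P K"
    unfolding K_def by (simp add: compactin_PiE)
  then have "compact K" by (simp add: euclidean_product_topology)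
  moreover have "closed L"
    unfolding L_def
    by (intro closed_Int closed_INT ballI closed_Collect_eq continuous_intros continuous_on_product_coordinates)
  ultimately have compact: "compact (K \<inter> L)" by (rule compact_Int_closed)
  have img: "?b ` ?B = K \<inter> L"
  proof (intro equalityI subsetI)
    fix f assume "f \<in> ?b ` ?B"
    then obtain \<xi> where \<xi>: "norm \<xi> \<le> r" "f = ?b \<xi>" by auto
    have "norm (\<xi> x) \<le> r * norm x" for x
      using norm_blinfun[of \<xi> x] mult_right_mono[OF \<xi>(1), of "norm x"] by simp
    then show "f \<in> K \<inter> L"
      by (auto simp: K_def L_def \<xi> PiE_iff blinfun.bilinear_simps)
  next
    fix f assume f: "f \<in> K \<inter> L"
    have bound: "norm (f x) \<le> norm x * r" for x
      using PiE_mem[of f UNIV "\<lambda>x. cball 0 (r * norm x)" x] f by (simp add: K_def mult.commute)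
    have lin: "bounded_linear f"
      by (rule bounded_linear_intro[OF _ _ bound]) (use f in \<open>auto simp: L_def\<close>)
    have "norm (f x) \<le> r * norm x" for x using bound[of x] by (simp add: mult.commute)
    then have "Blinfun f \<in> ?B"
      using assms by (simp add: norm_blinfun_bound bounded_linear_Blinfun_apply[OF lin])
    then show "f \<in> ?b ` ?B" using bounded_linear_Blinfun_apply[OF lin] by (metis imageI)
  qed
  show ?thesis
    unfolding compactin_def
  proof (intro conjI allI impI)
    show "?B \<subseteq> topspace strong_operator_topology" by (simp add: strong_operator_topology_topspace)
    fix \<U> :: "('x \<Rightarrow>\<^sub>L real) set set"
    assume \<U>: "(\<forall>U\<in>\<U>. openin strong_operator_topology U) \<and> ?B \<subseteq> \<Union>\<U>"
    \<comment> \<open>The weak-star topology is pulled back along \<open>?b\<close>, so a cover of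
      the ball lifts to one of the compact image, and a finite subcover returns.\<close>
    then have "\<forall>U\<in>\<U>. \<exists>V. open V \<and> U = ?b -` V"
      by (auto simp: strong_operator_topology_def openin_pullback_topology)
    then obtain V where V: "\<And>U. U \<in> \<U> \<Longrightarrow> open (V U) \<and> U = ?b -` V U" by metis
    have "K \<inter> L \<subseteq> (\<Union>U\<in>\<U>. V U)"
    proof
      fix f assume "f \<in> K \<inter> L"
      then obtain \<xi> where "\<xi> \<in> ?B" "f = ?b \<xi>" unfolding img[symmetric] by blast
      then show "f \<in> (\<Union>U\<in>\<U>. V U)" using \<U> V by blast
    qed
    then obtain \<F> where \<F>: "\<F> \<subseteq> \<U>" "finite \<F>" "K \<inter> L \<subseteq> (\<Union>U\<in>\<F>. V U)"
      using compactE_image[OF compact, of \<U> V] V by blast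
    have "?B \<subseteq> \<Union>\<F>"
    proof
      fix \<xi> assume "\<xi> \<in> ?B"
      then have "?b \<xi> \<in> K \<inter> L" unfolding img[symmetric] by (rule imageI)
      then obtain U where "U \<in> \<F>" "?b \<xi> \<in> V U" using \<F>(3) by blast
      then show "\<xi> \<in> \<Union>\<F>" using V \<F>(1) by blast
    qed
    then show "\<exists>\<F>. finite \<F> \<and> \<F> \<subseteq> \<U> \<and> ?B \<subseteq> \<Union>\<F>" using \<F> by blast
  qed
qed

lemma Hausdorff_strong_operator_topology:
  "Hausdorff_space (strong_operator_topology :: ('x :: real_normed_vector \<Rightarrow>\<^sub>L real) topology)"
  unfolding Hausdorff_space_def
proof (intro allI impI)
  fix \<xi> \<eta> :: "'x \<Rightarrow>\<^sub>L real"
  assume "\<xi> \<in> topspace strong_operator_topology \<and> \<eta> \<in> topspace strong_operator_topology \<and> \<xi> \<noteq> \<eta>"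
  then obtain x where x: "blinfun_apply \<xi> x \<noteq> blinfun_apply \<eta> x" using blinfun_eqI by blast
  then obtain U V where UV: "open U" "open V" "blinfun_apply \<xi> x \<in> U" "blinfun_apply \<eta> x \<in> V" "U \<inter> V = {}"
    using hausdorff[OF x] by metis
  have op: "openin strong_operator_topology {\<zeta> :: 'x \<Rightarrow>\<^sub>L real. blinfun_apply \<zeta> x \<in> W}" if "open W" for W
    using openin_continuous_map_preimage[OF strong_operator_topology_continuous_evaluation, of W x] that
    by (simp add: strong_operator_topology_topspace)
  show "\<exists>U V. openin strong_operator_topology U \<and> openin strong_operator_topology V \<and>
      \<xi> \<in> U \<and> \<eta> \<in> V \<and> disjnt U V"
  proof (intro exI conjI)
    show "disjnt {\<zeta> :: 'x \<Rightarrow>\<^sub>L real. blinfun_apply \<zeta> x \<in> U} {\<zeta>. blinfun_apply \<zeta> x \<in> V}"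
      using UV(5) by (auto simp: disjnt_def)
  qed (use UV op in simp_all)
qed

text \<open>A norm bound is a family of bounds at single vectors, each of which is weak-star closed
  by continuity of evaluation.\<close>

lemma closedin_dual_cball:
  "closedin strong_operator_topology (cball (\<eta> :: 'x :: real_normed_vector \<Rightarrow>\<^sub>L real) r)"
proof (cases "0 \<le> r")
  case True
  have "cball \<eta> r = (\<Inter>x. {\<xi>. \<bar>blinfun_apply \<xi> x - blinfun_apply \<eta> x\<bar> \<le> r * norm x})"
  proof (intro equalityI subsetI)
    fix \<xi> assume "\<xi> \<in> cball \<eta> r"
    then have n: "norm (\<xi> - \<eta>) \<le> r" by (simp add: dist_norm norm_minus_commute)
    have "\<bar>\<xi> x - \<eta> x\<bar> \<le> r * norm x" for x
      using norm_blinfun[of "\<xi> - \<eta>" x] mult_right_mono[OF n, of "norm x"]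
      by (simp add: blinfun.diff_left)
    then show "\<xi> \<in> (\<Inter>x. {\<xi>. \<bar>blinfun_apply \<xi> x - blinfun_apply \<eta> x\<bar> \<le> r * norm x})" by simp
  next
    fix \<xi> assume "\<xi> \<in> (\<Inter>x. {\<xi>. \<bar>blinfun_apply \<xi> x - blinfun_apply \<eta> x\<bar> \<le> r * norm x})"
    then have "norm (\<xi> - \<eta>) \<le> r"
      by (intro norm_blinfun_bound True) (simp add: blinfun.diff_left)
    then show "\<xi> \<in> cball \<eta> r" by (simp add: dist_norm norm_minus_commute)
  qed
  moreover have "closedin strong_operator_topology
      {\<xi> :: 'x \<Rightarrow>\<^sub>L real. \<bar>blinfun_apply \<xi> x - blinfun_apply \<eta> x\<bar> \<le> r * norm x}" for x
  proof -
    have "closed {v :: real. \<bar>v - blinfun_apply \<eta> x\<bar> \<le> r * norm x}"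
      by (intro closed_Collect_le continuous_intros)
    then show ?thesis
      using closedin_continuous_map_preimage[OF strong_operator_topology_continuous_evaluation,
          of "{v :: real. \<bar>v - blinfun_apply \<eta> x\<bar> \<le> r * norm x}" x]
      by (simp add: strong_operator_topology_topspace)
  qed
  ultimately show ?thesis by (simp add: closedin_INT)
qed (simp add: not_le)

section \<open>Szlenk derived sets of the dual ball\<close>

text \<open>The removed points are those covered by weak-star open sets that meet \<open>F\<close>
  in a set of small diameter.\<close>

lemma closedin_szlenk_derivation:
  assumes "closedin strong_operator_topology F"
  shows "closedin strong_operator_topology (szlenk_derivation e F)"
proof -
  have "szlenk_derivation e F =
      F - \<Union>{U. openin strong_operator_topology U \<and> diameter (U \<inter> F) < e}"
  proof (intro set_eqI iffI)
    fix \<xi> assume "\<xi> \<in> szlenk_derivation e F"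
    then show "\<xi> \<in> F - \<Union>{U. openin strong_operator_topology U \<and> diameter (U \<inter> F) < e}"
      unfolding szlenk_derivation_def using not_le by blast
  next
    fix \<xi> assume "\<xi> \<in> F - \<Union>{U. openin strong_operator_topology U \<and> diameter (U \<inter> F) < e}"
    then show "\<xi> \<in> szlenk_derivation e F"
      unfolding szlenk_derivation_def using leI by blast
  qed
  moreover have "openin strong_operator_topology
      (\<Union>{U. openin strong_operator_topology U \<and> diameter (U \<inter> F) < e})"
    by (rule openin_Union) simp
  ultimately show ?thesis using closedin_diff[OF assms] by simp
qed

lemma closedin_szlenk_derived:
  assumes "closedin strong_operator_topology F"
  shows "closedin strong_operator_topology (szlenk_derived e F b)"
proof (induction b rule: ordinal_induct)
  case zero
  then show ?case using assms by (simp add: szlenk_derived_zero)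
next
  case (osuc b)
  then show ?case by (simp add: szlenk_derived_osuc closedin_szlenk_derivation)
next
  case (olimit b)
  \<comment> \<open>Closedness of the intersection requires a nonempty index set; 0 lies below every
    limit.\<close>
  then have "b \<noteq> 0" by (simp add: olimit_def)
  then have "{..<b} \<noteq> {}" using ordinal_zero_le[of b] by (metis lessThan_iff empty_iff order_less_le)
  then show ?case using olimit.IH
    unfolding szlenk_derived_olimit[OF olimit.hyps] by (intro closedin_INT) auto
qed

text \<open>This is a Baire category argument. Separability covers \<open>F\<close> by countably
  many small norm balls, which are weak-star closed, so one of them has interior relative to the
  compact Hausdorff set \<open>F\<close>; points of that interior are removed.\<close>

lemma szlenk_derivation_psubset:
  fixes F :: "('x :: real_normed_vector \<Rightarrow>\<^sub>L real) set"
  assumes sep: "separable_space (euclidean :: ('x \<Rightarrow>\<^sub>L real) topology)"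
    and F: "compactin strong_operator_topology F" "F \<noteq> {}" and e: "0 < e"
  shows "szlenk_derivation e F \<noteq> F"
proof
  assume eq: "szlenk_derivation e F = F"
  let ?X = "subtopology strong_operator_topology F"
  have top: "topspace ?X = F" by (simp add: strong_operator_topology_topspace)
  have "compact_space ?X" using F(1) by (simp add: compactin_subspace)
  moreover have "Hausdorff_space ?X"
    by (rule Hausdorff_space_subtopology[OF Hausdorff_strong_operator_topology])
  ultimately have X: "locally_compact_space ?X \<and> regular_space ?X"
    by (simp add: compact_imp_locally_compact_space compact_Hausdorff_imp_regular_space)
  obtain C :: "('x \<Rightarrow>\<^sub>L real) set" where C: "countable C" "closure C = UNIV"
    using sep by (auto simp: separable_space_def)
  \<comment> \<open>Radius \<open>e / 3\<close> gives diameter at most \<open>2 * (e / 3)\<close>,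
    strictly below \<open>e\<close>.\<close>
  let ?G = "(\<lambda>c. F \<inter> cball c (e / 3)) ` C"
  have "F \<subseteq> \<Union>?G"
  proof
    fix \<xi> assume "\<xi> \<in> F"
    moreover obtain c where "c \<in> C" "dist c \<xi> < e / 3"
      using C(2) closure_approachable[of \<xi> C] e by (metis UNIV_I divide_pos_pos zero_less_numeral)
    ultimately show "\<xi> \<in> \<Union>?G" by (auto intro: order_less_imp_le)
  qed
  then have "\<Union>?G = topspace ?X" unfolding top by blast
  then have "?X interior_of \<Union>?G \<noteq> {}"
    using F(2) top by (metis interior_of_topspace)
  then obtain G where G: "G \<in> ?G" "\<not> (closedin ?X G \<and> ?X interior_of G = {})"
    using Baire_category_alt[of ?X ?G] X C(1) by (metis countable_image)
  then obtain c where c: "G = F \<inter> cball c (e / 3)" by blast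
  have "closedin ?X G"
    unfolding c by (rule closedin_subtopology_Int_closed[OF closedin_dual_cball])
  then obtain \<xi> where "\<xi> \<in> ?X interior_of G" using G(2) by blast
  then obtain T where T: "openin ?X T" "\<xi> \<in> T" "T \<subseteq> G" unfolding interior_of_def by blast
  then obtain U where U: "openin strong_operator_topology U" "T = U \<inter> F"
    by (auto simp: openin_subtopology)
  have "diameter (U \<inter> F) \<le> diameter (cball c (e / 3))"
    using T(3) U(2) c by (intro diameter_subset) auto
  also have "\<dots> < e"
  proof -
    have "diameter (cball c (e / 3)) \<le> 2 * (e / 3)"
    proof (rule diameter_le)
      fix x y assume "x \<in> cball c (e / 3)" "y \<in> cball c (e / 3)"
      then show "norm (x - y) \<le> 2 * (e / 3)"
        using dist_triangle3[of x y c] by (simp add: dist_norm)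
    qed (use e in simp)
    then show ?thesis using e by simp
  qed
  finally have "\<xi> \<notin> szlenk_derivation e F"
    using U T(2) by (auto simp: szlenk_derivation_def not_le)
  then show False using eq T(2) U(2) by blast
qed

text \<open>The derived sets become stationary, and a nonempty stationary one would be a weak-star
  compact set fixed by the derivation. Hence the least ordinal defining \<open>Sz\<close>
  exists.\<close>

lemma szlenk_derived_Sz:
  assumes sep: "separable_space (euclidean :: ('x :: real_normed_vector \<Rightarrow>\<^sub>L real) topology)"
    and e: "0 < e"
  shows "szlenk_derived e (cball (0 :: 'x \<Rightarrow>\<^sub>L real) 1) (Sz TYPE('x) e) = {}"
proof -
  let ?F = "szlenk_derived e (cball (0 :: 'x \<Rightarrow>\<^sub>L real) 1)"
  obtain a :: "('x \<Rightarrow>\<^sub>L real) ordinal" where a: "?F (osuc a) = ?F a"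
    using szlenk_derived_stationary by blast
  have "?F a \<subseteq> cball 0 1"
    using szlenk_derived_antimono[OF ordinal_zero_le] by (metis szlenk_derived_zero)
  then have "compactin strong_operator_topology (?F a)"
    by (rule closed_compactin[OF compactin_dual_cball[OF zero_le_one] _ closedin_szlenk_derived[OF closedin_dual_cball]])
  then have "?F a = {}"
    using szlenk_derivation_psubset[OF sep _ _ e] a by (metis szlenk_derived_osuc)
  then show ?thesis unfolding Sz_def by (rule LeastI)
qed

text \<open>Boundedness of \<open>F\<close> makes \<open>diameter\<close> dominate the distance of
  any two points.\<close>

lemma szlenk_derivation_complement:
  assumes "\<xi> \<in> F" "\<xi> \<notin> szlenk_derivation e F" "bounded F"
  obtains U where "openin strong_operator_topology U" "\<xi> \<in> U"
    "\<And>\<eta> \<zeta>. \<eta> \<in> U \<inter> F \<Longrightarrow> \<zeta> \<in> U \<inter> F \<Longrightarrow> dist \<eta> \<zeta> < e"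
proof -
  obtain U where U: "openin strong_operator_topology U" "\<xi> \<in> U" "diameter (U \<inter> F) < e"
    using assms(1,2) by (auto simp: szlenk_derivation_def not_le)
  have "bounded (U \<inter> F)" using assms(3) by (rule bounded_subset) simp
  then have "dist \<eta> \<zeta> < e" if "\<eta> \<in> U \<inter> F" "\<zeta> \<in> U \<inter> F" for \<eta> \<zeta>
    using diameter_bounded_bound[OF _ that] U(3) by (meson order_le_less_trans)
  then show thesis using U that by blast
qed

section \<open>Application to the evaluation functionals\<close>

theorem corollary5p2:
  fixes i :: "'x::banach \<Rightarrow> (cantor \<Rightarrow>\<^sub>C real)" and \<epsilon> :: real
  assumes "separable_space (euclidean :: ('x \<Rightarrow>\<^sub>L real) topology)"
    and "linear i" and "\<And>x. norm (i x) = norm x"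
    and "\<epsilon> > 0"
  shows "\<exists>\<alpha> Y. countable {..<\<alpha>} \<and> \<alpha> < oexp \<omega> (Sz TYPE('x) (\<epsilon> / 2) + \<omega>) \<and>
    subspace Y \<and> isometrically_isomorphic_C Y {0..\<alpha>} \<and>
    (\<forall>x. \<exists>y\<in>Y. norm (i x - y) \<le> \<epsilon> * norm x)"
proof -
  let ?ball = "cball (0 :: 'x \<Rightarrow>\<^sub>L real) 1" and ?e = "\<epsilon> / 2"
  define q where "q t = Blinfun (\<lambda>x. i x t)" for t
  have val: "norm (i x t) \<le> norm x" for x t
    using norm_bounded[of "i x" t] assms(3) by simp
  have "bounded_linear (\<lambda>x. i x t)" for t
    by (rule bounded_linear_intro[where K = 1])
      (use val in \<open>simp_all add: linear_add[OF assms(2)] linear_scale[OF assms(2)]\<close>)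
  then have q_apply: "blinfun_apply (q t) x = i x t" for t x
    by (simp add: q_def bounded_linear_Blinfun_apply)
  have "norm (q t) \<le> 1" for t
    by (rule norm_blinfun_bound) (use val in \<open>simp_all add: q_apply\<close>)
  then have q_ball: "q t \<in> ?ball" for t by simp
  have q_cont: "continuous_map euclidean strong_operator_topology q"
    unfolding continuous_on_strong_operator_topo_iff_coordinatewise
    by (simp add: q_apply continuous_on_apply_bcontfun)
  define F :: "('x \<Rightarrow>\<^sub>L real) ordinal \<Rightarrow> _" where "F = szlenk_derived ?e ?ball"
  define E where "E b = q -` F b" for b
  \<comment> \<open>Two points may share a fibre only if their evaluation functionals are this
    close; a point leaving \<open>F b\<close> supplies exactly this estimate.\<close>
  define R where "R s t \<longleftrightarrow> dist (q s) (q t) < ?e" for s t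
  have F_ball: "F b \<subseteq> ?ball" for b
    using szlenk_derived_antimono[OF ordinal_zero_le] unfolding F_def by (metis szlenk_derived_zero)
  have resolv: "resolvable R UNIV (oexp \<omega> (Sz TYPE('x) ?e))"
  proof (rule resolvable_derived_empty[of E])
    show "closed (E b)" for b
      using closedin_continuous_map_preimage[OF q_cont closedin_szlenk_derived[OF closedin_dual_cball]]
      by (simp add: E_def F_def vimage_def)
    show "E 0 = UNIV" using q_ball by (auto simp: E_def F_def szlenk_derived_zero)
    show "E b = (\<Inter>c<b. E c)" if "olimit b" for b
      using that by (auto simp: E_def F_def szlenk_derived_olimit)
    show "E c \<subseteq> E b" if "b \<le> c" for b c
      unfolding E_def F_def by (rule vimage_mono[OF szlenk_derived_antimono[OF that]])
    show "\<exists>U. open U \<and> t \<in> U \<and> (\<forall>s\<in>U \<inter> E b. \<forall>s'\<in>U \<inter> E b. R s s')"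
      if "t \<in> E b" "t \<notin> E (osuc b)" for b t
    proof -
      have "q t \<in> F b" "q t \<notin> szlenk_derivation ?e (F b)" "bounded (F b)"
        using that bounded_subset[OF bounded_cball F_ball] by (simp_all add: E_def F_def szlenk_derived_osuc)
      then obtain U where U: "openin strong_operator_topology U" "q t \<in> U"
        "\<And>\<eta> \<zeta>. \<eta> \<in> U \<inter> F b \<Longrightarrow> \<zeta> \<in> U \<inter> F b \<Longrightarrow> dist \<eta> \<zeta> < ?e"
        by (rule szlenk_derivation_complement) blast
      have "open (q -` U)"
        using openin_continuous_map_preimage[OF q_cont U(1)] by (simp add: vimage_def)
      then show ?thesis using U(2,3) by (intro exI[of _ "q -` U"]) (simp add: E_def R_def)
    qed
    show "UNIV \<inter> E (Sz TYPE('x) ?e) = {}"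
      using szlenk_derived_Sz[OF assms(1), of ?e] assms(4) by (simp add: E_def F_def)
  qed simp_all
  then obtain a \<phi> where a: "a < oexp \<omega> (Sz TYPE('x) ?e)" and \<phi>: "ordinal_map R UNIV a \<phi>"
    unfolding resolvable_def by blast
  note cont = ordinal_map_continuous[OF \<phi>]
  have "compact (range \<phi>)" using compact_continuous_image[OF cont compact_cantor] .
  \<comment> \<open>The initial segment \<open>{..<a}\<close> is compact as an image of the Cantor
    set, so it has a maximum and is a closed interval \<open>{0..\<alpha>}\<close>.\<close>
  then obtain \<alpha> where \<alpha>: "\<alpha> \<in> range \<phi>" "\<forall>b\<in>range \<phi>. b \<le> \<alpha>"
    using compact_attains_sup by (metis UNIV_not_empty image_is_empty)
  have rng: "range \<phi> = {..<a}" using \<phi> by (simp add: ordinal_map_def)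
  have rng': "range \<phi> = {0..\<alpha>}"
    using \<alpha> unfolding rng by (auto simp: ordinal_zero_le)
  have less: "\<alpha> < a" using \<alpha>(1) unfolding rng by simp
  define Y where "Y = (\<lambda>f. Bcontfun (f \<circ> \<phi>)) ` cont_functions {0..\<alpha>}"
  have Y: "subspace Y" "isometrically_isomorphic_C Y {0..\<alpha>}"
    using isometrically_isomorphic_C_compose[OF compact_cantor cont] by (simp_all add: Y_def rng')
  have "countable {..<\<alpha>}"
    by (rule countable_subset[of _ "{..<a}"]) (use \<phi> less in \<open>auto simp: ordinal_map_def\<close>)
  moreover have "\<alpha> < oexp \<omega> (Sz TYPE('x) ?e + \<omega>)"
    using order_less_le_trans[OF order_less_trans[OF less a] oexp_omega_mono[OF le_oplus_left]] .
  moreover have "\<exists>y\<in>Y. norm (i x - y) \<le> \<epsilon> * norm x" for x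
  \<comment> \<open>The fibre estimate is strict and thus needs \<open>norm x > 0\<close>; at 0 the
    zero function serves.\<close>
  proof (cases "x = 0")
    case True
    then show ?thesis using subspace_0[OF Y(1)] linear_0[OF assms(2)] by (intro bexI[of _ 0]) simp_all
  next
    case False
    \<comment> \<open>The difference is the value of \<open>q s - q t\<close> at \<open>x\<close>,
      and this functional has norm below \<open>\<epsilon> / 2\<close> on a fibre.\<close>
    have "\<bar>i x s - i x t\<bar> < \<epsilon> * norm x" if "\<phi> s = \<phi> t" for s t
    proof -
      have d: "norm (q s - q t) < ?e" using \<phi> that by (simp add: ordinal_map_def R_def dist_norm)
      have "\<bar>i x s - i x t\<bar> \<le> norm (q s - q t) * norm x"
        using norm_blinfun[of "q s - q t" x] by (simp add: blinfun.diff_left q_apply)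
      also have "\<dots> < \<epsilon> * norm x"
        using d False assms(4) by (intro mult_strict_right_mono) auto
      finally show ?thesis .
    qed
    then obtain f where f: "f \<in> cont_functions {0..\<alpha>}" "\<forall>t. \<bar>i x t - f (\<phi> t)\<bar> \<le> \<epsilon> * norm x"
      using cont_functions_approx[OF compact_cantor continuous_on_apply_bcontfun cont _ rng', of "i x"]
      by blast
    have "norm (i x - Bcontfun (f \<circ> \<phi>)) \<le> \<epsilon> * norm x"
      using f bcontfun_compose[OF compact_cantor cont, of f]
      by (intro norm_bound) (simp add: rng')
    then show ?thesis using f(1) by (auto simp: Y_def)
  qed
  ultimately show ?thesis using Y by blast
qed

end
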